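(* Let $n\ge 1$ and let $f(x,y,\omega)=\sum_i f_i(\omega)\,\phi(x-x_i(\omega),y-y_i(\omega))$ be the random obstacle field described in the context (satisfying the obstacle shape condition and the obstacle distribution condition stated there). For $u:\mathbb{R}^n\to\mathbb{R}$ write $$\kappa(u)=\operatorname{div}\left(\frac{\nabla u}{n\sqrt{1+|\nabla u|^2}}\right).$$ Then there exist a (deterministic) constant $F^*>0$ and a non-negative function $w:\mathbb{R}^n\times\Omega\to[0,\infty)$ such that, almost surely, $$0\ \ge\ \kappa(w(\cdot,\omega))(x)+f(x,w(x,\omega),\omega)+F^*\qquad\text{on }\mathbb{R}^n$$ (in the sense of viscosity solutions); that is, $w$ is a non-negative stationary supersolution, so that any solution $u$ of $$\partial_t u=\sqrt{1+|\nabla u|^2}\,\bigl(\kappa(u)+f(x,u,\omega)+F\bigr)\quad\text{on }\mathbb{R}^n,\qquad u(x,0,\omega)=0,$$ with $F\le F^*$ gets pinned, i.e. by the comparison principle $u(x,t,\omega)\le w(x,\omega)$ for all $t\ge0$ and $x\in\mathbb{R}^n$.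
   Context: Let $(\Omega,\mathcal{F},\mathbf{P})$ be a probability space. $\|\cdot\|$ denotes the Euclidean norm and $\|\cdot\|_\infty$ the maximum norm on $\mathbb{R}^{n+1}=\mathbb{R}^n\times\mathbb{R}$. The operator $\kappa(u)$ is the mean curvature (normalized by $1/n$) of the graph of $u$. Obstacle shape condition: $\phi\in C^\infty(\mathbb{R}^n\times\mathbb{R})$ and there exist $r_1,r_0$ with $r_1>\sqrt{n}\,r_0>0$ such that (i) $\phi\le 0$, and $\phi(x,y)=0$ whenever $\|(x,y)\|>r_1$; (ii) $\phi(x,y)\le -1$ whenever $\|(x,y)\|_\infty\le r_0$. Obstacle distribution condition: the random obstacle centers $\{(x_k,y_k)\}_{k\in\mathbb{N}}\subset\mathbb{R}^n\times[r_1,\infty)$ and strengths $\{f_k\}_{k\in\mathbb{N}}\subset[0,\infty)$ satisfy: (i) the $(x_k,y_k)$ are distributed according to an $(n+1)$-dimensional Poisson process on $\mathbb{R}^n\times[r_1,\infty)$ with intensity $\lambda>0$; (ii) the $f_k$ are i.i.d. strictly positive random variables which are independent of $\{(x_k,y_k)\}_{k}$. Solutions $u$ of the evolution equation are understood in a class for which the comparison principle for forced mean curvature flow of graphs holds (a solution with initial condition below a stationary supersolution remains below it). *)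

theory Defs
  imports "HOL-Probability.Probability"
begin

section \<open>Differentiability classes\<close>

text \<open>Functions all of whose iterated partial derivatives up to order \<open>k\<close> exist and are
  continuous on the whole space.\<close>

primrec C_class :: "nat \<Rightarrow> ('a::euclidean_space \<Rightarrow> real) \<Rightarrow> bool" where
  "C_class 0 g \<longleftrightarrow> continuous_on UNIV g"
| "C_class (Suc k) g \<longleftrightarrow> g differentiable_on UNIV \<and>
     (\<forall>b\<in>Basis. C_class k (\<lambda>x. frechet_derivative g (at x) b))"

definition C_infinity :: "('a::euclidean_space \<Rightarrow> real) \<Rightarrow> bool" where
  "C_infinity g \<longleftrightarrow> (\<forall>k. C_class k g)"


section \<open>Mean curvature of graphs\<close>

definition grad :: "(real ^ 'n \<Rightarrow> real) \<Rightarrow> real ^ 'n \<Rightarrow> real ^ 'n" where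
  "grad u x = (\<chi> i. frechet_derivative u (at x) (axis i 1))"

definition divergence :: "(real ^ 'n \<Rightarrow> real ^ 'n) \<Rightarrow> real ^ 'n \<Rightarrow> real" where
  "divergence V x = (\<Sum>i\<in>UNIV. frechet_derivative V (at x) (axis i 1) $ i)"

text \<open>Only applied to \<open>C\<^sup>2\<close> functions below, so that all derivatives involved exist.\<close>

definition mean_curv :: "(real ^ 'n \<Rightarrow> real) \<Rightarrow> real ^ 'n \<Rightarrow> real" where
  "mean_curv u =
     divergence (\<lambda>x. grad u x /\<^sub>R (real CARD('n) * sqrt (1 + (norm (grad u x))\<^sup>2)))"


section \<open>Viscosity solutions\<close>

text \<open>In this section \<open>f x y\<close> is an arbitrary (deterministic) forcing field and \<open>F\<close> a constant
  driving force.\<close>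

definition lower_semicont :: "('a::topological_space \<Rightarrow> real) \<Rightarrow> bool" where
  "lower_semicont g \<longleftrightarrow> (\<forall>c. open {x. c < g x})"

text \<open>Viscosity sense of \<open>0 \<ge> \<kappa>(w)(x) + f(x, w(x)) + F\<close> on the whole space: the inequality is
  tested with \<open>C\<^sup>2\<close> functions touching \<open>w\<close> from below (up to an additive constant).\<close>

definition stationary_supersolution ::
    "(real ^ 'n \<Rightarrow> real \<Rightarrow> real) \<Rightarrow> real \<Rightarrow> (real ^ 'n \<Rightarrow> real) \<Rightarrow> bool" where
  "stationary_supersolution f F w \<longleftrightarrow> lower_semicont w \<and>
     (\<forall>\<psi> x\<^sub>0. C_class 2 \<psi> \<longrightarrow>
        (\<forall>\<^sub>F x in nhds x\<^sub>0. w x\<^sub>0 - \<psi> x\<^sub>0 \<le> w x - \<psi> x) \<longrightarrow>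
        0 \<ge> mean_curv \<psi> x\<^sub>0 + f x\<^sub>0 (w x\<^sub>0) + F)"

text \<open>Viscosity solutions of
  \<open>\<partial>\<^sub>t u = \<surd>(1 + \<bar>\<nabla>u\<bar>\<^sup>2) (\<kappa>(u) + f(x, u) + F)\<close> for \<open>t > 0\<close>, continuous up to \<open>t = 0\<close>. The test functions
  live on space-time; \<open>flow_speed\<close> is the right-hand side in which the spatial derivatives are
  those of the test function \<open>\<psi>\<close> and \<open>y\<close> stands for the value of \<open>u\<close>.\<close>

definition flow_speed ::
    "(real ^ 'n \<Rightarrow> real \<Rightarrow> real) \<Rightarrow> real \<Rightarrow> (real ^ 'n \<Rightarrow> real) \<Rightarrow> real ^ 'n \<Rightarrow> real \<Rightarrow> real" where
  "flow_speed f F \<psi> x y =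
     sqrt (1 + (norm (grad \<psi> x))\<^sup>2) * (mean_curv \<psi> x + f x y + F)"

definition flow_solution ::
    "(real ^ 'n \<Rightarrow> real \<Rightarrow> real) \<Rightarrow> real \<Rightarrow> (real ^ 'n \<Rightarrow> real \<Rightarrow> real) \<Rightarrow> bool" where
  "flow_solution f F u \<longleftrightarrow>
     continuous_on (UNIV \<times> {0..}) (\<lambda>(x, t). u x t) \<and>
     (\<forall>\<psi> x\<^sub>0. \<forall>t\<^sub>0>0. C_class 2 \<psi> \<longrightarrow>
        (\<forall>\<^sub>F (x, t) in nhds (x\<^sub>0, t\<^sub>0). u x t - \<psi> (x, t) \<le> u x\<^sub>0 t\<^sub>0 - \<psi> (x\<^sub>0, t\<^sub>0)) \<longrightarrow>
        deriv (\<lambda>t. \<psi> (x\<^sub>0, t)) t\<^sub>0 \<le> flow_speed f F (\<lambda>x. \<psi> (x, t\<^sub>0)) x\<^sub>0 (u x\<^sub>0 t\<^sub>0)) \<and>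
     (\<forall>\<psi> x\<^sub>0. \<forall>t\<^sub>0>0. C_class 2 \<psi> \<longrightarrow>
        (\<forall>\<^sub>F (x, t) in nhds (x\<^sub>0, t\<^sub>0). u x\<^sub>0 t\<^sub>0 - \<psi> (x\<^sub>0, t\<^sub>0) \<le> u x t - \<psi> (x, t)) \<longrightarrow>
        deriv (\<lambda>t. \<psi> (x\<^sub>0, t)) t\<^sub>0 \<ge> flow_speed f F (\<lambda>x. \<psi> (x, t\<^sub>0)) x\<^sub>0 (u x\<^sub>0 t\<^sub>0))"

text \<open>A class of solutions for which the comparison principle holds: a solution that is
  initially below a stationary supersolution remains below it. No such principle is asserted
  for the class of all viscosity solutions, as forcing and solutions may be unbounded.\<close>

definition comparison_class ::
    "(real ^ 'n \<Rightarrow> real \<Rightarrow> real) \<Rightarrow> real \<Rightarrow> (real ^ 'n \<Rightarrow> real \<Rightarrow> real) set \<Rightarrow> bool" where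
  "comparison_class f F U \<longleftrightarrow>
     (\<forall>u\<in>U. flow_solution f F u) \<and>
     (\<forall>u\<in>U. \<forall>v. stationary_supersolution f F v \<longrightarrow> (\<forall>x. u x 0 \<le> v x) \<longrightarrow>
        (\<forall>t\<ge>0. \<forall>x. u x t \<le> v x))"


section \<open>Random obstacles\<close>

text \<open>The product norm on \<open>(real ^ 'n) \<times> real\<close> is Euclidean and \<open>infnorm\<close> is the maximum norm.\<close>

definition obstacle_shape :: "((real ^ 'n) \<times> real \<Rightarrow> real) \<Rightarrow> real \<Rightarrow> real \<Rightarrow> bool" where
  "obstacle_shape \<phi> r\<^sub>0 r\<^sub>1 \<longleftrightarrow>
     C_infinity \<phi> \<and> r\<^sub>1 > sqrt (real CARD('n)) * r\<^sub>0 \<and> sqrt (real CARD('n)) * r\<^sub>0 > 0 \<and>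
     (\<forall>z. \<phi> z \<le> 0) \<and> (\<forall>z. norm z > r\<^sub>1 \<longrightarrow> \<phi> z = 0) \<and>
     (\<forall>z. infnorm z \<le> r\<^sub>0 \<longrightarrow> \<phi> z \<le> -1)"

text \<open>Number of points in \<open>B\<close>, counted with multiplicity and possibly infinite.\<close>

definition point_count :: "(nat \<Rightarrow> '\<omega> \<Rightarrow> 'a) \<Rightarrow> 'a set \<Rightarrow> '\<omega> \<Rightarrow> ennreal" where
  "point_count z B \<omega> = emeasure (count_space UNIV) {k. z k \<omega> \<in> B}"

text \<open>The random points \<open>z k\<close> enumerate a homogeneous Poisson process on the region \<open>S\<close> with
  intensity \<open>l\<close>. Families indexed by \<open>nat\<close> cover the finite ones (append empty sets).\<close>

definition poisson_process ::
    "'\<omega> measure \<Rightarrow> 'a::euclidean_space set \<Rightarrow> real \<Rightarrow> (nat \<Rightarrow> '\<omega> \<Rightarrow> 'a) \<Rightarrow> bool" where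
  "poisson_process M S l z \<longleftrightarrow>
     (\<forall>k. z k \<in> borel_measurable M) \<and>
     (\<forall>k. \<forall>\<omega>\<in>space M. z k \<omega> \<in> S) \<and>
     (\<forall>B\<in>sets borel. B \<subseteq> S \<longrightarrow> emeasure lborel B < \<infinity> \<longrightarrow>
        (\<forall>m::nat. measure M {\<omega>\<in>space M. point_count z B \<omega> = of_nat m} =
           (l * measure lborel B) ^ m / fact m * exp (- (l * measure lborel B)))) \<and>
     (\<forall>B::nat \<Rightarrow> 'a set. range B \<subseteq> sets borel \<longrightarrow> (\<forall>j. B j \<subseteq> S) \<longrightarrow>
        (\<forall>j. emeasure lborel (B j) < \<infinity>) \<longrightarrow> disjoint_family B \<longrightarrow>
        prob_space.indep_vars M (\<lambda>_. borel) (\<lambda>j. point_count z (B j)) UNIV)"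

text \<open>The strengths are non-negative everywhere and positive almost surely. The last conjunct
  is the independence of the \<open>\<sigma>\<close>-algebras generated by the two whole sequences;
  \<open>indep_var\<close> would need both sequences to have the same type.\<close>

definition obstacle_distribution ::
    "'\<omega> measure \<Rightarrow> real \<Rightarrow> real \<Rightarrow> (nat \<Rightarrow> '\<omega> \<Rightarrow> (real ^ 'n) \<times> real) \<Rightarrow> (nat \<Rightarrow> '\<omega> \<Rightarrow> real) \<Rightarrow> bool"
  where
  "obstacle_distribution M r\<^sub>1 l z s \<longleftrightarrow>
     l > 0 \<and> poisson_process M (UNIV \<times> {r\<^sub>1..}) l z \<and>
     (\<forall>k. \<forall>\<omega>\<in>space M. s k \<omega> \<ge> 0) \<and> (\<forall>k. AE \<omega> in M. s k \<omega> > 0) \<and>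
     prob_space.indep_vars M (\<lambda>_. borel) s UNIV \<and>
     (\<forall>k. distr M borel (s k) = distr M borel (s 0)) \<and>
     prob_space.indep_set M
       (sets (vimage_algebra (space M) (\<lambda>\<omega> k. s k \<omega>) (PiM UNIV (\<lambda>_. borel))))
       (sets (vimage_algebra (space M) (\<lambda>\<omega> k. z k \<omega>) (PiM UNIV (\<lambda>_. borel))))"

text \<open>Almost surely the sum is locally finite: the centers have no accumulation point and \<open>\<phi>\<close> has
  compact support.\<close>

definition obstacle_field ::
    "((real ^ 'n) \<times> real \<Rightarrow> real) \<Rightarrow> (nat \<Rightarrow> '\<omega> \<Rightarrow> (real ^ 'n) \<times> real) \<Rightarrow> (nat \<Rightarrow> '\<omega> \<Rightarrow> real) \<Rightarrow>
      '\<omega> \<Rightarrow> real ^ 'n \<Rightarrow> real \<Rightarrow> real" where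
  "obstacle_field \<phi> z s \<omega> x y = (\<Sum>k. s k \<omega> * \<phi> ((x, y) - z k \<omega>))"

end

theory Submission
  imports Defs
begin

text \<open>
  The supersolution is a minimum of rotationally symmetric barriers, one over each of a family of
  strong obstacles that form a Lipschitz surface.

  A barrier centred at an obstacle \<open>(p, y)\<close> is the graph of \<open>y + G (\<bar>x - p\<bar>\<^sup>2)\<close>. Close to \<open>p\<close> it is a
  paraboloid, whose small positive curvature is outweighed by the obstacle; further out it is
  \<open>const - const * \<bar>x - p\<bar> powr - \<alpha>\<close> with \<open>\<alpha> = n - 1/2\<close>. As \<open>\<alpha>\<close> exceeds the exponent \<open>n - 2\<close> of the
  fundamental solution, the curvature out there is strictly negative, and on a ball of radius \<open>R\<close> it
  stays below some \<open>- F < 0\<close> (\<open>mean_curv_le_inside_barrier\<close>, \<open>mean_curv_le_outside_barrier\<close>). A test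
  function that touches a minimum of such barriers from below at a point touches the barrier that
  attains the minimum there, so the minimum is a supersolution as soon as the minimum is never
  attained at the rim \<open>\<bar>x - p\<bar> = R\<close> of a barrier (\<open>barrier_min_supersolution\<close>).

  To compare barriers with each other, cut space into boxes with horizontal side \<open>d\<close> and height \<open>h\<close>
  and choose one obstacle in every column of boxes, such that the heights in nearby columns differ by
  at most one box. Every point has a centre within distance \<open>n d\<close>, so with \<open>R = 2 n d\<close> the rim is
  avoided if the barrier rises by at least \<open>2 h\<close> between the radii \<open>n d\<close> and \<open>2 n d\<close>. For the
  boxes to contain strong obstacles with a given probability, only their volume \<open>C = d ^ n * h\<close>
  matters. Hence \<open>h\<close> is of order \<open>d powr - n\<close>, whereas the rise is of order \<open>d powr - \<alpha>\<close> with
  \<open>\<alpha> < n\<close>: flat wide boxes satisfy the requirement (\<open>exists_cell_size\<close>).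

  That obstacles can be chosen in this way is Lipschitz percolation (\<open>lipschitz_percolation\<close>): the
  surface runs just above the set of boxes that can be reached from height zero by paths which climb
  only into boxes without a strong obstacle and otherwise step down sideways. A shortest path to
  height \<open>m\<close> climbs into at least \<open>m\<close> distinct such boxes, and its length is at most twice the number
  of climbs, so a union bound over paths shows that great heights are not reached if boxes without
  strong obstacle are rare. The probability that all boxes of a finite family lack a strong obstacle is
  bounded in \<open>no_strong_obstacle_probability\<close>.
\<close>

section \<open>Curvature of test functions that touch radial functions\<close>

lemma second_derivative_nonneg_at_min:
  fixes \<eta> :: "real \<Rightarrow> real"
  assumes "\<forall>\<^sub>F t in nhds 0. (\<eta> has_real_derivative \<eta>' t) (at t)"
    and "(\<eta>' has_real_derivative c) (at 0)"
    and "\<forall>\<^sub>F t in nhds 0. \<eta> 0 \<le> \<eta> t"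
  shows "\<eta>' 0 = 0" and "0 \<le> c"
proof -
  obtain e where e: "e > 0" and d: "\<And>t. \<bar>t\<bar> < e \<Longrightarrow> (\<eta> has_real_derivative \<eta>' t) (at t)"
    and m: "\<And>t. \<bar>t\<bar> < e \<Longrightarrow> \<eta> 0 \<le> \<eta> t"
    using eventually_conj[OF assms(1,3)] unfolding eventually_nhds_metric
    by (auto simp: dist_real_def)
  show 0: "\<eta>' 0 = 0"
    by (rule DERIV_local_min[OF d[of 0] e]) (use e m in auto)
  show "0 \<le> c"
  proof (rule ccontr)
    assume "\<not> 0 \<le> c"
    then have "c < 0" by simp
    from DERIV_neg_dec_right[OF assms(2) this] obtain e' where e': "e' > 0"
      and neg: "\<And>h. 0 < h \<Longrightarrow> h < e' \<Longrightarrow> \<eta>' h < 0" using 0 by auto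
    define t where "t = min e e' / 2"
    have t: "0 < t" "t < e" "t < e'" using e e' by (auto simp: t_def)
    obtain x where x: "0 < x" "x < t" "\<eta> t - \<eta> 0 = (t - 0) * \<eta>' x"
      using MVT2[of 0 t \<eta> \<eta>'] d t by auto
    have "(t - 0) * \<eta>' x < 0" using neg[of x] x t by (simp add: mult_pos_neg)
    then show False using x m[of t] t by auto
  qed
qed

lemma C_class_2_gradient:
  fixes \<psi> :: "real ^ 'n \<Rightarrow> real"
  assumes "C_class 2 \<psi>"
  obtains H where "\<And>x. (\<psi> has_derivative (\<lambda>v. grad \<psi> x \<bullet> v)) (at x)"
    and "\<And>x. (grad \<psi> has_derivative H x) (at x)"
proof -
  have c: "\<psi> differentiable_on UNIV" "\<And>i. (\<lambda>x. frechet_derivative \<psi> (at x) (axis i 1)) differentiable_on UNIV"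
    using assms by (auto simp: numeral_2_eq_2 Basis_vec_def)
  have d: "(\<psi> has_derivative frechet_derivative \<psi> (at x)) (at x)" for x
    using c(1) by (simp add: differentiable_on_def frechet_derivative_works)
  have g: "frechet_derivative \<psi> (at x) v = grad \<psi> x \<bullet> v" for x v
  proof -
    interpret linear "frechet_derivative \<psi> (at x)"
      using d has_derivative_linear by blast
    have "frechet_derivative \<psi> (at x) v = frechet_derivative \<psi> (at x) (\<Sum>i\<in>UNIV. (v $ i) *\<^sub>R axis i 1)"
      by (simp add: basis_expansion scalar_mult_eq_scaleR[symmetric])
    also have "\<dots> = grad \<psi> x \<bullet> v"
      by (simp add: sum scale grad_def inner_vec_def mult.commute)
    finally show ?thesis .
  qed
  have "(grad \<psi> has_derivative (\<lambda>v. \<chi> i. frechet_derivative (\<lambda>x. grad \<psi> x $ i) (at x) v)) (at x)" for x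
  proof (subst has_derivative_componentwise_within, rule ballI)
    fix b :: "real ^ 'n" assume "b \<in> Basis"
    then obtain i where b: "b = axis i 1" by (auto simp: Basis_vec_def)
    have "(\<lambda>x. grad \<psi> x $ i) differentiable (at x)"
      using c(2)[of i] by (simp add: grad_def differentiable_on_def)
    then show "((\<lambda>x. grad \<psi> x \<bullet> b) has_derivative (\<lambda>v. (\<chi> i. frechet_derivative (\<lambda>x. grad \<psi> x $ i) (at x) v) \<bullet> b)) (at x)"
      by (simp add: b inner_axis frechet_derivative_works)
  qed
  with d g that show thesis by (metis (no_types, lifting) has_derivative_eq_rhs ext)
qed

text \<open>
  With \<open>A\<close> the Hessian and \<open>p\<close> the gradient, the numerator of the curvature is
  \<open>(1 + \<bar>p\<bar>\<^sup>2) tr A - p \<bullet> A p\<close>. Its quadratic part is half the sum of the values of the quadratic form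
  \<open>A\<close> at the vectors \<open>p\<^sub>i e\<^sub>j - p\<^sub>j e\<^sub>i\<close>. In this form it is monotone in the second derivatives along
  lines, which is all that is known of a test function; moreover these vectors are orthogonal to \<open>p\<close>.
\<close>

lemma mean_curv_eq:
  fixes \<psi> :: "real ^ 'n \<Rightarrow> real"
  assumes "(grad \<psi> has_derivative H) (at x)"
  defines "p \<equiv> grad \<psi> x"
  shows "real CARD('n) * mean_curv \<psi> x * sqrt (1 + (norm p)\<^sup>2) ^ 3
    = (\<Sum>i\<in>UNIV. H (axis i 1) $ i)
     + (\<Sum>i\<in>UNIV. \<Sum>j\<in>UNIV. H (p $ i *\<^sub>R axis j 1 - p $ j *\<^sub>R axis i 1) \<bullet> (p $ i *\<^sub>R axis j 1 - p $ j *\<^sub>R axis i 1)) / 2"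
proof -
  define n where "n = real CARD('n)"
  define s where "s = sqrt (1 + (norm p)\<^sup>2)"
  have n: "n > 0" by (simp add: n_def)
  have s: "s > 0" "s\<^sup>2 = 1 + p \<bullet> p" by (auto simp: s_def add_pos_nonneg power2_norm_eq_inner)
  interpret H: linear H using assms(1) has_derivative_linear by blast
  have pos: "1 + grad \<psi> y \<bullet> grad \<psi> y > 0" for y by (simp add: add_pos_nonneg)
  have "((\<lambda>x. grad \<psi> x /\<^sub>R (n * sqrt (1 + grad \<psi> x \<bullet> grad \<psi> x))) has_derivative
     (\<lambda>v. (1 / (n * s)) *\<^sub>R H v - ((p \<bullet> H v) / (n * s ^ 3)) *\<^sub>R p)) (at x)"
  proof -
    have ss: "sqrt (1 + p \<bullet> p) = s" by (simp add: s_def power2_norm_eq_inner)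
    have inv: "((\<lambda>x. inverse (n * sqrt (1 + grad \<psi> x \<bullet> grad \<psi> x))) has_derivative (\<lambda>v. - (p \<bullet> H v) / (n * s ^ 3))) (at x)"
    proof (rule has_derivative_eq_rhs)
      show "((\<lambda>x. inverse (n * sqrt (1 + grad \<psi> x \<bullet> grad \<psi> x))) has_derivative
        (\<lambda>v. - (inverse n * (inverse s * ((p \<bullet> H v) * inverse s) * inverse s)))) (at x)"
        using n s(1) pos[of x]
        by (auto intro!: derivative_eq_intros assms(1) simp: p_def[symmetric] ss inner_commute[of "H _" p])
      show "(\<lambda>v. - (inverse n * (inverse s * ((p \<bullet> H v) * inverse s) * inverse s))) = (\<lambda>v. - (p \<bullet> H v) / (n * s ^ 3))"
        using n s(1) by (simp add: fun_eq_iff field_simps power3_eq_cube)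
    qed
    show ?thesis
      by (rule has_derivative_eq_rhs[OF has_derivative_scaleR[OF inv assms(1)]])
        (simp add: fun_eq_iff ss p_def[symmetric] inverse_eq_divide)
  qed
  then have D: "frechet_derivative (\<lambda>x. grad \<psi> x /\<^sub>R (n * sqrt (1 + (norm (grad \<psi> x))\<^sup>2))) (at x)
     = (\<lambda>v. (1 / (n * s)) *\<^sub>R H v - ((p \<bullet> H v) / (n * s ^ 3)) *\<^sub>R p)"
    unfolding power2_norm_eq_inner by (rule frechet_derivative_at[symmetric])
  have "n * mean_curv \<psi> x * s ^ 3 = (\<Sum>i\<in>UNIV. n * s ^ 3 * (H (axis i 1) $ i / (n * s) - (p \<bullet> H (axis i 1)) / (n * s ^ 3) * p $ i))"
    unfolding mean_curv_def divergence_def n_def[symmetric] D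
    by (simp add: sum_distrib_left sum_distrib_right mult_ac)
  also have "\<dots> = (\<Sum>i\<in>UNIV. s\<^sup>2 * H (axis i 1) $ i - (p \<bullet> H (axis i 1)) * p $ i)"
    using n s(1) by (intro sum.cong refl) (simp add: field_simps power2_eq_square power3_eq_cube)
  also have "\<dots> = (\<Sum>i\<in>UNIV. H (axis i 1) $ i) + (p \<bullet> p) * (\<Sum>i\<in>UNIV. H (axis i 1) $ i)
      - (\<Sum>i\<in>UNIV. \<Sum>j\<in>UNIV. p $ j * H (axis i 1) $ j * p $ i)"
    by (simp add: s(2) algebra_simps sum.distrib sum_subtractf sum_distrib_left inner_vec_def sum_distrib_right)
      (rule sum.swap)
  finally have lhs: "n * mean_curv \<psi> x * s ^ 3 = (\<Sum>i\<in>UNIV. H (axis i 1) $ i) + (p \<bullet> p) * (\<Sum>i\<in>UNIV. H (axis i 1) $ i)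
      - (\<Sum>i\<in>UNIV. \<Sum>j\<in>UNIV. p $ j * H (axis i 1) $ j * p $ i)" .
  have "(\<Sum>i\<in>UNIV. \<Sum>j\<in>UNIV. H (p $ i *\<^sub>R axis j 1 - p $ j *\<^sub>R axis i 1) \<bullet> (p $ i *\<^sub>R axis j 1 - p $ j *\<^sub>R axis i 1))
     = (\<Sum>i\<in>UNIV. \<Sum>j\<in>UNIV. (p $ i)\<^sup>2 * H (axis j 1) $ j + (p $ j)\<^sup>2 * H (axis i 1) $ i
        - p $ i * H (axis j 1) $ i * p $ j - p $ j * H (axis i 1) $ j * p $ i)"
    by (intro sum.cong refl)
      (simp add: H.diff H.scale inner_diff_left inner_diff_right inner_axis algebra_simps power2_eq_square)
  also have "\<dots> = 2 * ((p \<bullet> p) * (\<Sum>i\<in>UNIV. H (axis i 1) $ i)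
      - (\<Sum>i\<in>UNIV. \<Sum>j\<in>UNIV. p $ j * H (axis i 1) $ j * p $ i))"
  proof -
    have 1: "(\<Sum>i\<in>UNIV. \<Sum>j\<in>UNIV. (p $ i)\<^sup>2 * H (axis j 1) $ j) = (p \<bullet> p) * (\<Sum>i\<in>UNIV. H (axis i 1) $ i)"
      unfolding inner_vec_def sum_product by (simp add: power2_eq_square)
    have 2: "(\<Sum>i\<in>UNIV. \<Sum>j\<in>UNIV. (p $ j)\<^sup>2 * H (axis i 1) $ i) = (p \<bullet> p) * (\<Sum>i\<in>UNIV. H (axis i 1) $ i)"
      unfolding 1[symmetric] by (rule sum.swap)
    have 3: "(\<Sum>i\<in>UNIV. \<Sum>j\<in>UNIV. p $ i * H (axis j 1) $ i * p $ j) = (\<Sum>i\<in>UNIV. \<Sum>j\<in>UNIV. p $ j * H (axis i 1) $ j * p $ i)"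
      by (rule sum.swap)
    show ?thesis unfolding sum.distrib sum_subtractf 1 2 3 by simp
  qed
  finally show ?thesis using lhs unfolding n_def s_def by simp
qed

text \<open>
  Restricted to any line through \<open>x\<^sub>0\<close>, the difference of the radial function and \<open>\<psi>\<close> has a local
  minimum at \<open>x\<^sub>0\<close>. This gives the gradient of \<open>\<psi>\<close> and bounds for its second derivatives along lines.
  The right-hand side is the numerator of the curvature of the radial function itself: in the
  directions orthogonal to \<open>x\<^sub>0 - c\<close> its second derivative is just \<open>2 G'\<close>.
\<close>

lemma mean_curv_le_of_radial_touch:
  fixes \<psi> :: "real ^ 'n \<Rightarrow> real" and G G' :: "real \<Rightarrow> real" and c x\<^sub>0 :: "real ^ 'n"
  defines "q \<equiv> (norm (x\<^sub>0 - c))\<^sup>2"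
  defines "P \<equiv> 4 * (G' q)\<^sup>2 * q"
  assumes \<psi>: "C_class 2 \<psi>"
    and touch: "\<forall>\<^sub>F x in nhds x\<^sub>0. \<psi> x - \<psi> x\<^sub>0 \<le> G ((norm (x - c))\<^sup>2) - G q"
    and G: "\<forall>\<^sub>F r in nhds q. (G has_real_derivative G' r) (at r)"
    and G': "(G' has_real_derivative G'') (at q)"
  shows "real CARD('n) * mean_curv \<psi> x\<^sub>0 * sqrt (1 + P) ^ 3
     \<le> 4 * G'' * q + 2 * real CARD('n) * G' q + 2 * (real CARD('n) - 1) * G' q * P"
proof -
  obtain H where d\<psi>: "\<And>x. (\<psi> has_derivative (\<lambda>v. grad \<psi> x \<bullet> v)) (at x)"
    and H: "\<And>x. (grad \<psi> has_derivative H x) (at x)"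
    using C_class_2_gradient[OF \<psi>] by blast
  define \<xi> where "\<xi> = x\<^sub>0 - c"
  define p where "p = grad \<psi> x\<^sub>0"
  have lin: "H x (t *\<^sub>R v) = t *\<^sub>R H x v" for x t v
    using has_derivative_linear[OF H[of x]] by (simp add: linear_scale)
  have line: "p \<bullet> v = 2 * G' q * (\<xi> \<bullet> v) \<and> H x\<^sub>0 v \<bullet> v \<le> 4 * G'' * (\<xi> \<bullet> v)\<^sup>2 + 2 * G' q * (v \<bullet> v)" for v
  proof -
    define Q where "Q t = (norm (x\<^sub>0 + t *\<^sub>R v - c))\<^sup>2" for t
    define \<eta> where "\<eta> t = G (Q t) - \<psi> (x\<^sub>0 + t *\<^sub>R v)" for t
    define \<eta>' where "\<eta>' t = G' (Q t) * (2 * (\<xi> \<bullet> v) + 2 * t * (v \<bullet> v)) - grad \<psi> (x\<^sub>0 + t *\<^sub>R v) \<bullet> v" for t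
    have Q: "Q t = \<xi> \<bullet> \<xi> + 2 * t * (\<xi> \<bullet> v) + t\<^sup>2 * (v \<bullet> v)" for t
      unfolding Q_def \<xi>_def power2_norm_eq_inner
      by (simp add: algebra_simps inner_commute power2_eq_square)
    have Q0: "Q 0 = q" by (simp add: Q_def q_def)
    have dQ: "(Q has_real_derivative (2 * (\<xi> \<bullet> v) + 2 * t * (v \<bullet> v))) (at t)" for t
      unfolding Q by (auto intro!: derivative_eq_intros)
    have cQ: "filterlim Q (nhds q) (nhds 0)"
      using DERIV_isCont[OF dQ[of 0]] Q0 by (simp add: continuous_at tendsto_nhds_iff)
    have cl: "filterlim (\<lambda>t. x\<^sub>0 + t *\<^sub>R v) (nhds x\<^sub>0) (nhds 0)"
      by (auto intro!: tendsto_eq_intros filterlim_ident)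
    have d\<psi>t: "((\<lambda>t. \<psi> (x\<^sub>0 + t *\<^sub>R v)) has_real_derivative (grad \<psi> (x\<^sub>0 + t *\<^sub>R v) \<bullet> v)) (at t)" for t
      unfolding has_field_derivative_def
      by (rule has_derivative_eq_rhs[OF has_derivative_compose[OF _ d\<psi>]])
        (auto intro!: derivative_eq_intros ext simp: inner_scaleR_right)
    have dgt: "((\<lambda>t. grad \<psi> (x\<^sub>0 + t *\<^sub>R v) \<bullet> v) has_real_derivative (H x\<^sub>0 v \<bullet> v)) (at 0)"
    proof -
      have "((\<lambda>t. grad \<psi> (x\<^sub>0 + t *\<^sub>R v)) has_derivative (\<lambda>t. H x\<^sub>0 (t *\<^sub>R v))) (at 0)"
        by (rule has_derivative_compose) (use H in \<open>auto intro!: derivative_eq_intros\<close>)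
      then show ?thesis unfolding has_field_derivative_def lin
        by (auto intro!: derivative_eq_intros ext)
    qed
    have 1: "\<forall>\<^sub>F t in nhds 0. (\<eta> has_real_derivative \<eta>' t) (at t)"
      using eventually_compose_filterlim[OF G cQ]
    proof eventually_elim
      case (elim t)
      show ?case unfolding \<eta>_def \<eta>'_def
        by (rule DERIV_diff[OF DERIV_chain2[OF elim dQ] d\<psi>t])
    qed
    have 2: "(\<eta>' has_real_derivative (4 * G'' * (\<xi> \<bullet> v)\<^sup>2 + 2 * G' q * (v \<bullet> v) - H x\<^sub>0 v \<bullet> v)) (at 0)"
      unfolding \<eta>'_def
      by (rule DERIV_cong[OF DERIV_diff[OF DERIV_mult[OF DERIV_chain2[OF G'[folded Q0] dQ]] dgt]])
        (auto intro!: derivative_eq_intros simp: Q0 power2_eq_square algebra_simps)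
    have 3: "\<forall>\<^sub>F t in nhds 0. \<eta> 0 \<le> \<eta> t"
      using eventually_compose_filterlim[OF touch cl]
      by eventually_elim (simp add: \<eta>_def Q_def q_def)
    show ?thesis
      using second_derivative_nonneg_at_min[OF 1 2 3] by (simp add: \<eta>'_def Q0 p_def)
  qed
  have p: "p = (2 * G' q) *\<^sub>R \<xi>"
    by (rule vector_eq_rdot[THEN iffD1]) (use line in auto)
  have q: "q = \<xi> \<bullet> \<xi>" by (simp add: q_def \<xi>_def power2_norm_eq_inner)
  have P: "P = p \<bullet> p" by (simp add: P_def p q power2_eq_square)
  have a: "(\<Sum>i\<in>UNIV. H x\<^sub>0 (axis i 1) $ i) \<le> (\<Sum>i\<in>UNIV. 4 * G'' * (\<xi> $ i)\<^sup>2 + 2 * G' q)"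
  proof (rule sum_mono)
    fix i show "H x\<^sub>0 (axis i 1) $ i \<le> 4 * G'' * (\<xi> $ i)\<^sup>2 + 2 * G' q"
      using line[of "axis i 1"] by (simp add: inner_axis inner_axis_axis)
  qed
  have b: "(\<Sum>i\<in>UNIV. \<Sum>j\<in>UNIV. H x\<^sub>0 (p $ i *\<^sub>R axis j 1 - p $ j *\<^sub>R axis i 1) \<bullet> (p $ i *\<^sub>R axis j 1 - p $ j *\<^sub>R axis i 1))
    \<le> (\<Sum>i\<in>UNIV. \<Sum>j\<in>UNIV. 2 * G' q * ((p $ i)\<^sup>2 + (p $ j)\<^sup>2 - (if j = i then 2 * (p $ i)\<^sup>2 else 0)))"
  proof (intro sum_mono)
    fix i j :: 'n
    let ?v = "p $ i *\<^sub>R axis j 1 - p $ j *\<^sub>R axis i 1 :: real ^ 'n"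
    have "\<xi> \<bullet> ?v = 0" by (simp add: inner_diff_right inner_axis p)
    moreover have "?v \<bullet> ?v = (p $ i)\<^sup>2 + (p $ j)\<^sup>2 - (if j = i then 2 * (p $ i)\<^sup>2 else 0)"
      by (simp add: inner_diff_right inner_diff_left inner_axis_axis power2_eq_square)
    ultimately show "H x\<^sub>0 ?v \<bullet> ?v \<le> 2 * G' q * ((p $ i)\<^sup>2 + (p $ j)\<^sup>2 - (if j = i then 2 * (p $ i)\<^sup>2 else 0))"
      using line[of ?v] by simp
  qed
  have c: "(\<Sum>i\<in>UNIV. \<Sum>j\<in>UNIV. 2 * G' q * ((p $ i)\<^sup>2 + (p $ j)\<^sup>2 - (if j = i then 2 * (p $ i)\<^sup>2 else 0)))
     = 4 * G' q * (real CARD('n) - 1) * P"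
  proof -
    have "(\<Sum>i\<in>UNIV. \<Sum>j\<in>UNIV. ((p $ i)\<^sup>2 + (p $ j)\<^sup>2 - (if j = i then 2 * (p $ i)\<^sup>2 else 0)))
      = 2 * (real CARD('n) - 1) * P"
      by (simp add: sum.distrib sum_subtractf sum.delta sum_distrib_left[symmetric] P inner_vec_def power2_eq_square left_diff_distrib)
    then show ?thesis by (simp add: sum_distrib_left[symmetric])
  qed
  have d: "(\<Sum>i\<in>UNIV. 4 * G'' * (\<xi> $ i)\<^sup>2 + 2 * G' q) = 4 * G'' * q + 2 * real CARD('n) * G' q"
    by (simp add: sum.distrib sum_distrib_left[symmetric] q inner_vec_def power2_eq_square)
  have "real CARD('n) * mean_curv \<psi> x\<^sub>0 * sqrt (1 + P) ^ 3
      \<le> (4 * G'' * q + 2 * real CARD('n) * G' q) + 4 * G' q * (real CARD('n) - 1) * P / 2"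
    unfolding d[symmetric] c[symmetric]
    using mean_curv_eq[OF H[of x\<^sub>0]] a b
    unfolding p_def[symmetric] P power2_norm_eq_inner by linarith
  then show ?thesis by (simp add: algebra_simps add_divide_distrib diff_divide_distrib)
qed

section \<open>Radial barriers\<close>

text \<open>
  The barrier as a function of the squared distance \<open>q\<close> to its centre: \<open>a q\<close> for \<open>q \<le> q\<^sub>0\<close>, and beyond
  \<open>q\<^sub>0\<close> the \<open>C\<^sup>1\<close> continuation of the form \<open>const - const * q powr - \<beta>\<close>. The truncations by \<open>min\<close> and
  \<open>max\<close> make continuity and monotonicity visible without a case distinction.
\<close>

definition profile :: "real \<Rightarrow> real \<Rightarrow> real \<Rightarrow> real \<Rightarrow> real" where
  "profile a q\<^sub>0 \<beta> q = a * (min q q\<^sub>0 + q\<^sub>0 / \<beta> * (1 - (max q q\<^sub>0 / q\<^sub>0) powr - \<beta>))"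

lemma profile_inner: "q\<^sub>0 > 0 \<Longrightarrow> q \<le> q\<^sub>0 \<Longrightarrow> profile a q\<^sub>0 \<beta> q = a * q"
  by (simp add: profile_def max_def)

lemma profile_outer: "q\<^sub>0 > 0 \<Longrightarrow> q\<^sub>0 \<le> q \<Longrightarrow>
    profile a q\<^sub>0 \<beta> q = a * (q\<^sub>0 + q\<^sub>0 / \<beta> * (1 - (q / q\<^sub>0) powr - \<beta>))"
  by (auto simp: profile_def max_def min_def)

lemma continuous_profile: "q\<^sub>0 > 0 \<Longrightarrow> continuous_on UNIV (profile a q\<^sub>0 \<beta>)"
  unfolding profile_def by (intro continuous_intros) (auto simp: max_def)

lemma profile_mono:
  assumes "a > 0" "q\<^sub>0 > 0" "\<beta> > 0" "q \<le> q'"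
  shows "profile a q\<^sub>0 \<beta> q \<le> profile a q\<^sub>0 \<beta> q'"
proof -
  have "(max q' q\<^sub>0 / q\<^sub>0) powr - \<beta> \<le> (max q q\<^sub>0 / q\<^sub>0) powr - \<beta>"
    using assms by (intro powr_mono2') (auto simp: max_def divide_right_mono)
  then show ?thesis unfolding profile_def
    using assms by (intro mult_left_mono add_mono) (auto intro!: mult_left_mono)
qed

lemma profile_nonneg: "a > 0 \<Longrightarrow> q\<^sub>0 > 0 \<Longrightarrow> \<beta> > 0 \<Longrightarrow> 0 \<le> q \<Longrightarrow> 0 \<le> profile a q\<^sub>0 \<beta> q"
  using profile_mono[of a q\<^sub>0 \<beta> 0 q] by (simp add: profile_inner)

text \<open>
  As the paraboloid lies above the barrier everywhere, a test function that touches the barrier in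
  the closed core touches the paraboloid. This deals with the points on the interface \<open>q = q\<^sub>0\<close>, where
  the barrier has no second derivatives.
\<close>

lemma profile_le_linear:
  assumes "a > 0" "q\<^sub>0 > 0" "\<beta> > 0"
  shows "profile a q\<^sub>0 \<beta> q \<le> a * q"
proof (cases "q \<le> q\<^sub>0")
  case False
  define t where "t = q / q\<^sub>0"
  have t: "t > 1" "q = q\<^sub>0 * t" using False assms by (auto simp: t_def)
  have "1 - \<beta> * ln t \<le> exp (- \<beta> * ln t)"
    using exp_ge_add_one_self[of "- \<beta> * ln t"] by simp
  also have "\<dots> = t powr - \<beta>" using t by (simp add: powr_def)
  finally have "1 - t powr - \<beta> \<le> \<beta> * ln t" by simp
  also have "\<dots> \<le> \<beta> * (t - 1)" using t assms ln_le_minus_one[of t] by simp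
  finally have "q\<^sub>0 / \<beta> * (1 - t powr - \<beta>) \<le> q\<^sub>0 / \<beta> * (\<beta> * (t - 1))"
    using assms by (intro mult_left_mono) auto
  then have "q\<^sub>0 + q\<^sub>0 / \<beta> * (1 - t powr - \<beta>) \<le> q" using assms t by (simp add: algebra_simps)
  then show ?thesis using False assms by (simp add: profile_outer t_def[symmetric])
qed (use assms in \<open>simp add: profile_inner\<close>)

lemma profile_outer_derivatives:
  fixes a q\<^sub>0 \<beta> q :: real
  assumes "q\<^sub>0 > 0" "\<beta> > 0" "q > q\<^sub>0"
  defines "G' \<equiv> \<lambda>q. a * (q / q\<^sub>0) powr (- \<beta> - 1)"
  shows "\<forall>\<^sub>F r in nhds q. (profile a q\<^sub>0 \<beta> has_real_derivative G' r) (at r)"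
    and "(G' has_real_derivative - (\<beta> + 1) * G' q / q) (at q)"
proof -
  have *: "(profile a q\<^sub>0 \<beta> has_real_derivative G' r) (at r)" if "r > q\<^sub>0" for r
  proof -
    have "((\<lambda>q. a * (q\<^sub>0 + q\<^sub>0 / \<beta> * (1 - (q / q\<^sub>0) powr - \<beta>))) has_real_derivative G' r) (at r)"
      unfolding G'_def using assms(1,2) that
      by (auto intro!: derivative_eq_intros simp: powr_diff field_simps)
    then show ?thesis
      by (rule has_field_derivative_transform_within_open[where S = "{q\<^sub>0<..}"])
        (use assms(1) that in \<open>auto simp: profile_outer\<close>)
  qed
  show "\<forall>\<^sub>F r in nhds q. (profile a q\<^sub>0 \<beta> has_real_derivative G' r) (at r)"
    using eventually_nhds_in_open[of "{q\<^sub>0<..}" q] assms(3) * by (auto elim: eventually_mono)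
  show "(G' has_real_derivative - (\<beta> + 1) * G' q / q) (at q)"
  proof -
    have "((\<lambda>q. q / q\<^sub>0) has_real_derivative 1 / q\<^sub>0) (at q)"
      using assms(1) by (auto intro!: derivative_eq_intros)
    then have "((\<lambda>q. (q / q\<^sub>0) powr (- \<beta> - 1)) has_real_derivative (- \<beta> - 1) * (q / q\<^sub>0) powr (- \<beta> - 1 - 1) * (1 / q\<^sub>0)) (at q)"
      by (rule DERIV_chain2[where g = "\<lambda>q. q / q\<^sub>0", OF has_real_derivative_powr, rotated]) (use assms(1,3) in simp)
    from DERIV_cmult[OF this, of a]
    have "(G' has_real_derivative a * ((- \<beta> - 1) * (q / q\<^sub>0) powr (- \<beta> - 1 - 1) * (1 / q\<^sub>0))) (at q)"
      unfolding G'_def .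
    moreover have "a * ((- \<beta> - 1) * (q / q\<^sub>0) powr (- \<beta> - 1 - 1) * (1 / q\<^sub>0)) = - (\<beta> + 1) * G' q / q"
      unfolding G'_def powr_diff[of _ "- \<beta> - 1" 1] using assms(1,3) by (simp add: field_simps)
    ultimately show ?thesis by simp
  qed
qed

lemma mean_curv_le_inside_barrier:
  fixes \<psi> :: "real ^ 'n \<Rightarrow> real"
  assumes "a > 0" "q\<^sub>0 > 0" "\<beta> > 0"
    and "C_class 2 \<psi>" "(norm (x\<^sub>0 - c))\<^sup>2 \<le> q\<^sub>0"
    and touch: "\<forall>\<^sub>F x in nhds x\<^sub>0. \<psi> x - \<psi> x\<^sub>0 \<le> profile a q\<^sub>0 \<beta> ((norm (x - c))\<^sup>2) - profile a q\<^sub>0 \<beta> ((norm (x\<^sub>0 - c))\<^sup>2)"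
  shows "mean_curv \<psi> x\<^sub>0 \<le> 2 * a"
proof -
  define n where "n = real CARD('n)"
  define P where "P = 4 * a\<^sup>2 * (norm (x\<^sub>0 - c))\<^sup>2"
  define s where "s = sqrt (1 + P)"
  have n: "n \<ge> 1" using zero_less_card_finite[where 'a = 'n] by (simp add: n_def Suc_le_eq)
  have P: "P \<ge> 0" by (simp add: P_def)
  have s: "s \<ge> 1" "s\<^sup>2 = 1 + P" using P by (auto simp: s_def)
  have "\<forall>\<^sub>F x in nhds x\<^sub>0. \<psi> x - \<psi> x\<^sub>0 \<le> a * (norm (x - c))\<^sup>2 - a * (norm (x\<^sub>0 - c))\<^sup>2"
    using touch
  proof eventually_elim
    case (elim x)
    then show ?case using profile_le_linear[OF assms(1-3), of "(norm (x - c))\<^sup>2"] profile_inner[OF assms(2,5), of a \<beta>] by simp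
  qed
  from mean_curv_le_of_radial_touch[OF assms(4) this, where G' = "\<lambda>_. a" and G'' = 0]
  have "n * mean_curv \<psi> x\<^sub>0 * s ^ 3 \<le> 2 * n * a + 2 * (n - 1) * a * P"
    by (auto intro!: derivative_eq_intros always_eventually simp: n_def P_def s_def)
  also have "\<dots> \<le> 2 * n * a * s\<^sup>2"
    using n P assms(1) by (simp add: s algebra_simps)
  also have "\<dots> \<le> n * (2 * a) * s ^ 3"
    using n assms(1) s(1) by (simp add: power_increasing)
  finally show ?thesis using n s(1) by simp
qed

text \<open>
  Up to the factor \<open>2 G'\<close>, the numerator of the curvature is \<open>n - 2 (\<beta> + 1) + (n - 1) P\<close>, where \<open>P\<close> is
  the squared slope. With \<open>\<beta> = (n - 1/2) / 2\<close> the constant part is \<open>- 3/2\<close>, and the bound on \<open>a\<close> makes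
  the slope so small that the nonlinear term does not spoil the sign.
\<close>

lemma mean_curv_le_outside_barrier:
  fixes \<psi> :: "real ^ 'n \<Rightarrow> real"
  defines "\<beta> \<equiv> (real CARD('n) - 1 / 2) / 2"
  assumes a: "a > 0" "8 * a\<^sup>2 * q\<^sub>0 * real CARD('n) \<le> 1" and q0: "q\<^sub>0 > 0"
    and "C_class 2 \<psi>" and q: "(norm (x\<^sub>0 - c))\<^sup>2 > q\<^sub>0"
    and touch: "\<forall>\<^sub>F x in nhds x\<^sub>0. \<psi> x - \<psi> x\<^sub>0 \<le> profile a q\<^sub>0 \<beta> ((norm (x - c))\<^sup>2) - profile a q\<^sub>0 \<beta> ((norm (x\<^sub>0 - c))\<^sup>2)"
  shows "mean_curv \<psi> x\<^sub>0 \<le> - (a / real CARD('n)) * ((norm (x\<^sub>0 - c))\<^sup>2 / q\<^sub>0) powr (- \<beta> - 1)"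
proof -
  define n where "n = real CARD('n)"
  define q where "q = (norm (x\<^sub>0 - c))\<^sup>2"
  define g where "g = a * (q / q\<^sub>0) powr (- \<beta> - 1)"
  define P where "P = 4 * g\<^sup>2 * q"
  define s where "s = sqrt (1 + P)"
  have n: "n \<ge> 1" using zero_less_card_finite[where 'a = 'n] by (simp add: n_def Suc_le_eq)
  have "\<beta> = n / 2 - 1 / 4" by (simp add: \<beta>_def n_def)
  then have \<beta>: "\<beta> > 0" "4 * (\<beta> + 1) = 2 * n + 3" using n by auto
  have qq: "q > q\<^sub>0" "q > 0" using q q0 by (auto simp: q_def)
  have g: "g > 0" using a q0 qq by (simp add: g_def)
  have "g\<^sup>2 * q = a\<^sup>2 * q\<^sub>0 * (((q / q\<^sub>0) powr (- \<beta> - 1))\<^sup>2 * (q / q\<^sub>0))"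
    using q0 by (simp add: g_def power_mult_distrib)
  also have "((q / q\<^sub>0) powr (- \<beta> - 1))\<^sup>2 * (q / q\<^sub>0) = (q / q\<^sub>0) powr (2 * (- \<beta> - 1) + 1)"
  proof -
    have "((q / q\<^sub>0) powr (- \<beta> - 1))\<^sup>2 = (q / q\<^sub>0) powr (2 * (- \<beta> - 1))"
      unfolding power2_eq_square powr_add[symmetric] by simp
    moreover have "(q / q\<^sub>0) powr (2 * (- \<beta> - 1) + 1) = (q / q\<^sub>0) powr (2 * (- \<beta> - 1)) * (q / q\<^sub>0)"
      using q0 qq by (subst powr_add) simp
    ultimately show ?thesis by simp
  qed
  also have "\<dots> \<le> (q / q\<^sub>0) powr 0" using q0 qq \<beta>(1) by (intro powr_mono) auto
  also have "\<dots> = 1" using q0 qq by simp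
  finally have "P \<le> 4 * (a\<^sup>2 * q\<^sub>0)" unfolding P_def using a q0 by (simp add: mult_left_mono)
  then have "2 * n * P \<le> 2 * n * (4 * (a\<^sup>2 * q\<^sub>0))" using n by (intro mult_left_mono) auto
  also have "\<dots> = 8 * a\<^sup>2 * q\<^sub>0 * n" by simp
  also have "\<dots> \<le> 1" using a(2) by (simp add: n_def)
  finally have nP: "2 * n * P \<le> 1" .
  have P: "P \<ge> 0" using qq by (simp add: P_def)
  have "P \<le> n * P" using n P by (simp add: mult_le_cancel_right1)
  then have P': "P \<le> 1 / 2" "2 * (n - 1) * P \<le> 1" using nP P by (auto simp: algebra_simps)
  have s: "s \<ge> 1" "s\<^sup>2 = 1 + P" using P by (auto simp: s_def)
  \<comment> \<open>This yields \<open>s ^ 3 \<le> 2\<close>, which absorbs the factor \<open>2\<close> in front of \<open>g\<close> below.\<close>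
  have "s \<le> 5 / 4"
    unfolding s_def by (rule real_le_lsqrt) (use P P' in \<open>auto simp: power2_eq_square\<close>)
  then have "s\<^sup>2 * s \<le> (3 / 2) * (5 / 4)" using s P' by (intro mult_mono) auto
  then have s3: "s ^ 3 \<le> 2" by (simp add: power3_eq_cube power2_eq_square)
  have "n * mean_curv \<psi> x\<^sub>0 * s ^ 3 \<le> 4 * (- (\<beta> + 1) * g / q) * q + 2 * n * g + 2 * (n - 1) * g * P"
    using mean_curv_le_of_radial_touch[OF assms(5) touch[unfolded \<beta>_def],
      OF profile_outer_derivatives[OF q0 _ q, where \<beta> = \<beta> and a = a, unfolded \<beta>_def]] \<beta>(1)
    by (simp add: n_def P_def s_def g_def q_def \<beta>_def)
  also have "4 * (- (\<beta> + 1) * g / q) * q = - (2 * n + 3) * g"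
    unfolding \<beta>(2)[symmetric] using qq by simp
  also have "- (2 * n + 3) * g + 2 * n * g + 2 * (n - 1) * g * P = g * (2 * (n - 1) * P - 3)"
    by (simp add: algebra_simps)
  also have "\<dots> \<le> g * (- 2)" using g P' by (intro mult_left_mono) auto
  finally have le: "n * mean_curv \<psi> x\<^sub>0 * s ^ 3 \<le> - 2 * g" by simp
  have "n * mean_curv \<psi> x\<^sub>0 \<le> - g"
  proof (rule ccontr)
    assume "\<not> ?thesis"
    then have "- g * s ^ 3 < n * mean_curv \<psi> x\<^sub>0 * s ^ 3" using s(1) by (intro mult_strict_right_mono) auto
    moreover have "g * s ^ 3 \<le> g * 2" using g s3 by (intro mult_left_mono) auto
    ultimately show False using le by simp
  qed
  then have "mean_curv \<psi> x\<^sub>0 \<le> - g / n" using n by (simp add: field_simps)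
  then show ?thesis by (simp add: g_def q_def n_def)
qed

section \<open>Minima of barriers\<close>

text \<open>
  Barriers are used only on balls of radius \<open>R\<close> because their curvature tends to zero at infinity.
  That the balls are closed makes the minimum lower semicontinuous.
\<close>

definition barrier_min ::
    "real \<Rightarrow> real \<Rightarrow> real \<Rightarrow> real \<Rightarrow> ('i \<Rightarrow> real ^ 'n) \<Rightarrow> ('i \<Rightarrow> real) \<Rightarrow> real ^ 'n \<Rightarrow> real" where
  "barrier_min a q\<^sub>0 \<beta> R X Y x =
     Min ((\<lambda>j. Y j + profile a q\<^sub>0 \<beta> ((norm (x - X j))\<^sup>2)) ` {j. norm (x - X j) \<le> R})"

text \<open>
  Near a given point only finitely many barriers matter, and one that is absent at the point because
  its ball does not contain it is absent in a neighbourhood, too.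
\<close>

lemma lower_semicont_barrier_min:
  assumes q0: "q\<^sub>0 > 0"
    and fin: "\<And>x r. finite {j. norm (x - X j) \<le> r}"
    and ne: "\<And>x. \<exists>j. norm (x - X j) \<le> R"
  shows "lower_semicont (barrier_min a q\<^sub>0 \<beta> R X Y)"
  unfolding lower_semicont_def
proof (intro allI)
  fix k
  define w where "w j x = Y j + profile a q\<^sub>0 \<beta> ((norm (x - X j))\<^sup>2)" for j x
  have w: "continuous_on UNIV (w j)" for j
    unfolding w_def
    by (intro continuous_intros continuous_on_compose2[OF continuous_profile[OF q0]]) auto
  have gt: "k < barrier_min a q\<^sub>0 \<beta> R X Y x \<longleftrightarrow> (\<forall>j. norm (x - X j) \<le> R \<longrightarrow> k < w j x)" for x
    unfolding barrier_min_def w_def using fin[of x R] ne[of x] by (subst Min_gr_iff) auto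
  show "open {x. k < barrier_min a q\<^sub>0 \<beta> R X Y x}"
  proof (subst open_subopen, rule ballI)
    fix x assume x: "x \<in> {x. k < barrier_min a q\<^sub>0 \<beta> R X Y x}"
    define J where "J = {j. norm (x - X j) \<le> R + 1}"
    \<comment> \<open>A point closer than \<open>1\<close> to \<open>x\<close> only sees barriers with centre within \<open>R + 1\<close> of \<open>x\<close>.\<close>
    define T where "T = ball x 1 \<inter> (\<Inter>j\<in>J. {y. R < norm (y - X j)} \<union> {y. k < w j y})"
    have "open T" unfolding T_def J_def
      by (intro open_Int open_ball open_INT fin ballI open_Un open_Collect_less w continuous_intros)
    moreover have "x \<in> T" using x by (auto simp: T_def gt not_less[symmetric])
    moreover have "T \<subseteq> {x. k < barrier_min a q\<^sub>0 \<beta> R X Y x}"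
    proof (clarsimp simp: gt)
      fix y j assume y: "y \<in> T" "norm (y - X j) \<le> R"
      have "norm (x - X j) \<le> norm (x - y) + norm (y - X j)" by (metis dist_norm dist_triangle)
      then have "j \<in> J" using y by (auto simp: T_def J_def dist_norm)
      then show "k < w j y" using y by (auto simp: T_def)
    qed
    ultimately show "\<exists>T. open T \<and> x \<in> T \<and> T \<subseteq> {x. k < barrier_min a q\<^sub>0 \<beta> R X Y x}" by blast
  qed
qed

text \<open>
  The hypothesis \<open>inner\<close> says that at the rim of its ball a barrier is beaten by another one. The
  barrier \<open>j\<close> that attains the minimum at \<open>x\<^sub>0\<close> is therefore defined in a neighbourhood of \<open>x\<^sub>0\<close>, where
  it lies above the minimum, and a test function that touches the minimum from below also touches \<open>j\<close>.
  In the core, the obstacle compensates the curvature of the paraboloid; outside, the curvature is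
  smallest in modulus at the rim, which determines the admissible \<open>F\<close>.
\<close>

lemma barrier_min_supersolution:
  fixes X :: "'i \<Rightarrow> real ^ 'n" and Y :: "'i \<Rightarrow> real"
  defines "\<beta> \<equiv> (real CARD('n) - 1 / 2) / 2"
  assumes a: "a > 0" "8 * a\<^sup>2 * q\<^sub>0 * real CARD('n) \<le> 1" and q0: "q\<^sub>0 > 0"
    and fin: "\<And>x r. finite {j. norm (x - X j) \<le> r}"
    and inner: "\<And>x. \<exists>i. norm (x - X i) \<le> R \<and> (\<forall>j. norm (x - X j) = R \<longrightarrow>
        Y i + profile a q\<^sub>0 \<beta> ((norm (x - X i))\<^sup>2) < Y j + profile a q\<^sub>0 \<beta> (R\<^sup>2))"
    and f_le: "\<And>x y. f x y \<le> 0"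
    and f_core: "\<And>x j. (norm (x - X j))\<^sup>2 \<le> q\<^sub>0 \<Longrightarrow> f x (Y j + a * (norm (x - X j))\<^sup>2) \<le> - (2 * a + F)"
    and F: "F \<le> a / real CARD('n) * (R\<^sup>2 / q\<^sub>0) powr (- \<beta> - 1)"
  shows "stationary_supersolution f F (barrier_min a q\<^sub>0 \<beta> R X Y)"
  unfolding stationary_supersolution_def
proof (intro conjI allI impI)
  have "(n - 1 / 2) / 2 > 0" if "n \<ge> 1" for n :: real using that by simp
  from this[of "real CARD('n)"] have \<beta>: "\<beta> > 0" unfolding \<beta>_def by (simp add: Suc_le_eq del: zero_less_divide_iff)
  show "lower_semicont (barrier_min a q\<^sub>0 \<beta> R X Y)"
    using lower_semicont_barrier_min[OF q0 fin] inner by meson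
  fix \<psi> :: "real ^ 'n \<Rightarrow> real" and x\<^sub>0
  assume \<psi>: "C_class 2 \<psi>"
    and touch: "\<forall>\<^sub>F x in nhds x\<^sub>0. barrier_min a q\<^sub>0 \<beta> R X Y x\<^sub>0 - \<psi> x\<^sub>0 \<le> barrier_min a q\<^sub>0 \<beta> R X Y x - \<psi> x"
  define w where "w j x = Y j + profile a q\<^sub>0 \<beta> ((norm (x - X j))\<^sup>2)" for j x
  have min_le: "barrier_min a q\<^sub>0 \<beta> R X Y x \<le> w j x" if "norm (x - X j) \<le> R" for x j
    unfolding barrier_min_def w_def using fin[of x R] that by (intro Min_le) auto
  obtain i where i: "norm (x\<^sub>0 - X i) \<le> R" "\<And>j. norm (x\<^sub>0 - X j) = R \<Longrightarrow> w i x\<^sub>0 < w j x\<^sub>0"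
    using inner[of x\<^sub>0] unfolding w_def by metis
  have "barrier_min a q\<^sub>0 \<beta> R X Y x\<^sub>0 \<in> (\<lambda>j. w j x\<^sub>0) ` {j. norm (x\<^sub>0 - X j) \<le> R}"
    unfolding barrier_min_def w_def using fin[of x\<^sub>0 R] i(1) by (intro Min_in) auto
  then obtain j where j: "norm (x\<^sub>0 - X j) \<le> R" "barrier_min a q\<^sub>0 \<beta> R X Y x\<^sub>0 = w j x\<^sub>0" by auto
  have "norm (x\<^sub>0 - X j) \<noteq> R" using min_le[OF i(1)] i(2)[of j] j(2) by auto
  with j(1) have "norm (x\<^sub>0 - X j) < R" by simp
  moreover have "open {x. norm (x - X j) < R}" by (intro open_Collect_less continuous_intros)
  ultimately have "\<forall>\<^sub>F x in nhds x\<^sub>0. norm (x - X j) < R"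
    using eventually_nhds_in_open[of "{x. norm (x - X j) < R}" x\<^sub>0] by simp
  with touch have *: "\<forall>\<^sub>F x in nhds x\<^sub>0. \<psi> x - \<psi> x\<^sub>0 \<le> profile a q\<^sub>0 \<beta> ((norm (x - X j))\<^sup>2) - profile a q\<^sub>0 \<beta> ((norm (x\<^sub>0 - X j))\<^sup>2)"
  proof eventually_elim
    case (elim x)
    then show ?case using min_le[of x j] j(2) by (simp add: w_def)
  qed
  show "0 \<ge> mean_curv \<psi> x\<^sub>0 + f x\<^sub>0 (barrier_min a q\<^sub>0 \<beta> R X Y x\<^sub>0) + F"
  proof (cases "(norm (x\<^sub>0 - X j))\<^sup>2 \<le> q\<^sub>0")
    case True
    then show ?thesis
      using mean_curv_le_inside_barrier[OF a(1) q0 \<beta> \<psi> True *] f_core[OF True] j(2)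
        profile_inner[OF q0 True, of a \<beta>] by (simp add: w_def)
  next
    case False
    have "(norm (x\<^sub>0 - X j))\<^sup>2 \<le> R\<^sup>2" using j(1) by (intro power_mono) auto
    then have "(R\<^sup>2 / q\<^sub>0) powr (- \<beta> - 1) \<le> ((norm (x\<^sub>0 - X j))\<^sup>2 / q\<^sub>0) powr (- \<beta> - 1)"
      using q0 \<beta> less_trans[OF q0, of "(norm (x\<^sub>0 - X j))\<^sup>2"] False
      by (intro powr_mono2' divide_pos_pos divide_right_mono) auto
    then have "a / real CARD('n) * (R\<^sup>2 / q\<^sub>0) powr (- \<beta> - 1) \<le> a / real CARD('n) * ((norm (x\<^sub>0 - X j))\<^sup>2 / q\<^sub>0) powr (- \<beta> - 1)"
      using a by (intro mult_left_mono) auto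
    moreover have "mean_curv \<psi> x\<^sub>0 \<le> - (a / real CARD('n)) * ((norm (x\<^sub>0 - X j))\<^sup>2 / q\<^sub>0) powr (- \<beta> - 1)"
      unfolding \<beta>_def by (rule mean_curv_le_outside_barrier[OF a q0 \<psi>]) (use False *[unfolded \<beta>_def] in auto)
    ultimately show ?thesis using F f_le[of x\<^sub>0 "barrier_min a q\<^sub>0 \<beta> R X Y x\<^sub>0"] by simp
  qed
qed

section \<open>Lipschitz percolation\<close>

text \<open>
  The predicate \<open>c v m\<close> says that the site at height \<open>m\<close> over \<open>v\<close> is closed. A path starts at height
  zero; it may climb only onto closed sites, and descend to any neighbouring column, the neighbours of
  \<open>v\<close> being \<open>v + e\<close> for \<open>e \<in> E\<close>. The number \<open>N\<close> is the length of the path.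
\<close>

inductive reach :: "'v::ab_group_add set \<Rightarrow> ('v \<Rightarrow> nat \<Rightarrow> bool) \<Rightarrow> nat \<Rightarrow> 'v \<Rightarrow> nat \<Rightarrow> bool"
  for E c where
  base: "reach E c 0 v 0"
| up: "reach E c N v m \<Longrightarrow> c v (Suc m) \<Longrightarrow> reach E c (Suc N) v (Suc m)"
| down: "reach E c N v (Suc m) \<Longrightarrow> e \<in> E \<Longrightarrow> reach E c (Suc N) (v + e) m"

text \<open>
  The possible sets of sites that a path of length \<open>N\<close> with end \<open>(v, m)\<close> climbs onto. The family
  depends only on \<open>E\<close> and not on which sites are closed, so that it can be used in a union bound.
\<close>

primrec ups :: "'v::ab_group_add set \<Rightarrow> nat \<Rightarrow> 'v \<Rightarrow> nat \<Rightarrow> ('v \<times> nat) set set" where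
  "ups E 0 v m = {{}}"
| "ups E (Suc N) v m = insert (v, m) ` ups E N v (m - 1) \<union> (\<Union>e\<in>E. ups E N (v - e) (Suc m))"

lemma finite_ups: "finite E \<Longrightarrow> finite (ups E N v m)"
  by (induction N arbitrary: v m) auto

lemma card_ups: "finite E \<Longrightarrow> card (ups E N v m) \<le> (card E + 1) ^ N"
proof (induction N arbitrary: v m)
  case (Suc N)
  have "card (ups E (Suc N) v m)
     \<le> card (insert (v, m) ` ups E N v (m - 1)) + card (\<Union>e\<in>E. ups E N (v - e) (Suc m))"
    by (simp add: card_Un_le)
  also have "\<dots> \<le> card (ups E N v (m - 1)) + (\<Sum>e\<in>E. card (ups E N (v - e) (Suc m)))"
    using Suc.prems by (intro add_mono card_image_le card_UN_le finite_ups)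
  also have "\<dots> \<le> (card E + 1) ^ N + (\<Sum>e\<in>E. (card E + 1) ^ N)"
    using Suc by (intro add_mono sum_mono) auto
  finally show ?case by simp
qed simp

text \<open>
  On a shortest path every vertex is at a distance equal to its position, so no site is visited twice
  and the number of climbs is the cardinality of the set \<open>S\<close>. The equation \<open>2 * card S = N + m\<close> is
  then the balance of climbs and descents.
\<close>

lemma shortest_path_ups:
  assumes "reach E c N v m" and "\<And>N'. reach E c N' v m \<Longrightarrow> N \<le> N'"
  shows "\<exists>S\<in>ups E N v m. finite S \<and> 2 * card S = N + m
     \<and> (\<forall>(u, k)\<in>S. c u k \<and> (\<exists>N'\<le>N. reach E c N' u k))"
  using assms
proof induction
  case (base v)
  show ?case by simp
next
  case (up N v m)
  have "N \<le> N'" if "reach E c N' v m" for N'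
    using up.prems[OF reach.up[OF that up.hyps(2)]] by simp
  from up.IH[OF this] obtain S where S: "S \<in> ups E N v m" "finite S" "2 * card S = N + m"
    "\<And>u k. (u, k) \<in> S \<Longrightarrow> c u k \<and> (\<exists>N'\<le>N. reach E c N' u k)" by fastforce
  \<comment> \<open>Elements of \<open>S\<close> are reached in at most \<open>N\<close> steps, the end of the path only in \<open>N + 1\<close>.\<close>
  have "(v, Suc m) \<notin> S" using S(4)[of v "Suc m"] up.prems by fastforce
  moreover have "insert (v, Suc m) S \<in> ups E (Suc N) v (Suc m)" using S(1) by simp
  moreover have "reach E c (Suc N) v (Suc m)" using up.hyps by (rule reach.up)
  moreover have "c u k \<and> (\<exists>N'\<le>Suc N. reach E c N' u k)" if "(u, k) \<in> S" for u k
    using S(4)[OF that] le_SucI by blast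
  ultimately show ?case using S(2,3) up.hyps(2)
    by (intro bexI[of _ "insert (v, Suc m) S"]) auto
next
  case (down N v m e)
  have "N \<le> N'" if "reach E c N' v (Suc m)" for N'
    using down.prems[OF reach.down[OF that down.hyps(2)]] by simp
  from down.IH[OF this] obtain S where S: "S \<in> ups E N v (Suc m)" "finite S" "2 * card S = N + Suc m"
    "\<And>u k. (u, k) \<in> S \<Longrightarrow> c u k \<and> (\<exists>N'\<le>N. reach E c N' u k)" by fastforce
  have "S \<in> ups E (Suc N) (v + e) m" using S(1) down.hyps(2) by (auto intro!: bexI[of _ e])
  moreover have "c u k \<and> (\<exists>N'\<le>Suc N. reach E c N' u k)" if "(u, k) \<in> S" for u k
    using S(4)[OF that] le_SucI by blast
  ultimately show ?case using S(2,3) by (intro bexI[of _ S]) auto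
qed

lemma reach_imp_many_closed:
  assumes "reach E c N v m"
  shows "\<exists>N\<ge>m. \<exists>S\<in>ups E N v m. finite S \<and> N \<le> 2 * card S \<and> (\<forall>(u, k)\<in>S. c u k)"
proof -
  define N\<^sub>0 where "N\<^sub>0 = (LEAST N. reach E c N v m)"
  have "reach E c N\<^sub>0 v m" "\<And>N'. reach E c N' v m \<Longrightarrow> N\<^sub>0 \<le> N'"
    unfolding N\<^sub>0_def using assms by (auto intro: LeastI Least_le)
  from this(1) shortest_path_ups[OF this] have "\<exists>S\<in>ups E N\<^sub>0 v m. finite S \<and> 2 * card S = N\<^sub>0 + m \<and> (\<forall>(u, k)\<in>S. c u k)"
    by fastforce
  moreover have "m \<le> N\<^sub>0" using \<open>reach E c N\<^sub>0 v m\<close> by induction auto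
  ultimately show ?thesis by (intro exI[of _ N\<^sub>0]) auto
qed

text \<open>
  Let \<open>\<Lambda> v\<close> be the least height from which on nothing over \<open>v\<close> is reached. The site just below is
  reached, so \<open>(v, \<Lambda> v)\<close> cannot be closed, as a path could climb onto it. From \<open>(v, \<Lambda> v - 1)\<close> a path
  can descend to height \<open>\<Lambda> v - 2\<close> in each neighbouring column, which gives the Lipschitz bound.
\<close>

lemma lipschitz_surface_above_reach:
  assumes "\<And>v. \<forall>\<^sub>F m in sequentially. \<forall>N. \<not> reach E c N v m"
  shows "\<exists>\<Lambda>. (\<forall>v. \<not> c v (\<Lambda> v)) \<and> (\<forall>v. \<forall>e\<in>E. \<Lambda> v \<le> Suc (\<Lambda> (v + e)))"
proof -
  define r where "r v m \<longleftrightarrow> (\<exists>N. reach E c N v m)" for v m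
  define \<Lambda> where "\<Lambda> v = (LEAST m. \<forall>k\<ge>m. \<not> r v k)" for v
  have above: "\<not> r v k" if "k \<ge> \<Lambda> v" for v k
  proof -
    have "\<exists>m. \<forall>k\<ge>m. \<not> r v k"
      using assms[of v] by (simp add: eventually_sequentially r_def)
    from LeastI_ex[OF this] show ?thesis using that unfolding \<Lambda>_def by blast
  qed
  have r0: "r v 0" for v using reach.base by (auto simp: r_def)
  then have pos: "\<Lambda> v > 0" for v using above[of v 0] by (cases "\<Lambda> v") auto
  have below: "r v (\<Lambda> v - 1)" for v
  proof (rule ccontr)
    assume n: "\<not> r v (\<Lambda> v - 1)"
    have "\<forall>k\<ge>\<Lambda> v - 1. \<not> r v k"
    proof (intro allI impI)
      fix k assume "k \<ge> \<Lambda> v - 1"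
      then show "\<not> r v k" using n above[where v = v and k = k] by (cases "k = \<Lambda> v - 1") auto
    qed
    then have "\<Lambda> v \<le> \<Lambda> v - 1" unfolding \<Lambda>_def by (rule Least_le)
    with pos[of v] show False by simp
  qed
  have "\<not> c v (\<Lambda> v)" for v
    using reach.up[of E c _ v "\<Lambda> v - 1"] below[of v] above[of v "\<Lambda> v"] pos[of v]
    by (auto simp: r_def)
  moreover have "\<Lambda> v \<le> Suc (\<Lambda> (v + e))" if "e \<in> E" for v e
  proof (cases "\<Lambda> v \<le> 1")
    case False
    then have "\<Lambda> v - 1 = Suc (\<Lambda> v - 2)" by simp
    then have "r (v + e) (\<Lambda> v - 2)"
      using below[of v] that reach.down[of E c _ v "\<Lambda> v - 2" e] by (auto simp: r_def)
    then have "\<not> \<Lambda> (v + e) \<le> \<Lambda> v - 2" using above by blast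
    then show ?thesis by simp
  qed simp
  ultimately show ?thesis by blast
qed

text \<open>
  The bound on the probability of a finite set of closed sites replaces independence. A path of
  length \<open>N\<close> that ends at a height \<open>m\<close> climbs onto at least \<open>N / 2\<close> sites, and there are at most
  \<open>(card E + 1) ^ N\<close> paths with a given end. So for fixed \<open>v\<close>, the probability that a shortest path of
  length \<open>N\<close> ends at some \<open>(v, m)\<close> with \<open>m \<le> N\<close> is at most
  \<open>(N + 1) * ((card E + 1) * sqrt q) ^ N\<close>. This is summable in \<open>N\<close>, and by the Borel-Cantelli lemma
  only finitely many \<open>N\<close> occur. Since reaching height \<open>m\<close> takes at least \<open>m\<close> steps, the heights
  reached over \<open>v\<close> are bounded.
\<close>

lemma (in prob_space) lipschitz_percolation:
  fixes C :: "'v::{ab_group_add, countable} \<Rightarrow> nat \<Rightarrow> 'a set"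
  assumes E: "finite E"
    and C: "\<And>v m. C v m \<in> events"
    and q: "\<And>S. finite S \<Longrightarrow> prob (space M \<inter> (\<Inter>(v, m)\<in>S. C v m)) \<le> q ^ card S"
    and q0: "0 \<le> q" "4 * (real (card E) + 1) * sqrt q \<le> 1"
  shows "AE \<omega> in M. \<exists>\<Lambda>. (\<forall>v. \<omega> \<notin> C v (\<Lambda> v)) \<and> (\<forall>v. \<forall>e\<in>E. \<Lambda> v \<le> Suc (\<Lambda> (v + e)))"
proof -
  \<comment> \<open>In \<open>D S\<close> all sites of \<open>S\<close> are closed; \<open>A v N\<close> contains the event that a shortest path of length \<open>N\<close> ends over \<open>v\<close>.\<close>
  define D where "D S = space M \<inter> (\<Inter>(v, m)\<in>S. C v m)" for S
  define U where "U v N m = {S \<in> ups E N v m. finite S \<and> N \<le> 2 * card S}" for v N m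
  define A where "A v N = (\<Union>m\<in>{..N}. \<Union>S\<in>U v N m. D S)" for v N
  have U: "finite (U v N m)" "card (U v N m) \<le> (card E + 1) ^ N" for v N m
    using finite_ups[OF E, of N v m] card_ups[OF E, of N v m]
      card_mono[OF finite_ups[OF E, of N v m], of "U v N m"] by (auto simp: U_def)
  have D: "D S \<in> events" if "finite S" for S
  proof -
    have "D S = {\<omega>\<in>space M. \<forall>x\<in>S. \<omega> \<in> C (fst x) (snd x)}" by (auto simp: D_def)
    then show ?thesis using C that by (auto intro!: sets.sets_Collect_finite_All' simp: sets.sets_Collect)
  qed
  have q1: "q \<le> 1"
  proof -
    have "sqrt q \<le> 4 * (real (card E) + 1) * sqrt q" using q0(1) by (simp add: mult_le_cancel_right1)
    then have "sqrt q \<le> 1" using q0(2) by linarith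
    then show ?thesis by simp
  qed
  have DU: "prob (D S) \<le> sqrt q ^ N" if "S \<in> U v N m" for S v N m
  proof -
    have "prob (D S) \<le> q ^ card S" unfolding D_def using that by (intro q) (simp add: U_def)
    also have "\<dots> = sqrt q ^ (2 * card S)" using q0(1) by (simp add: power_mult)
    also have "\<dots> \<le> sqrt q ^ N"
      using that q0 q1 by (intro power_decreasing) (auto simp: U_def)
    finally show ?thesis .
  qed
  have A: "A v N \<in> events" for v N
    unfolding A_def using U D by (auto intro!: sets.finite_UN simp: U_def)
  have PA: "prob (A v N) \<le> (1 / 2) ^ N" for v N
  proof -
    have "prob (A v N) \<le> (\<Sum>m\<in>{..N}. prob (\<Union>S\<in>U v N m. D S))"
      unfolding A_def using U D by (intro finite_measure_subadditive_finite) (auto intro!: sets.finite_UN simp: U_def)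
    also have "\<dots> \<le> (\<Sum>m\<in>{..N}. \<Sum>S\<in>U v N m. prob (D S))"
      using U D by (intro sum_mono finite_measure_subadditive_finite) (auto simp: U_def)
    also have "\<dots> \<le> (\<Sum>m\<in>{..N}. real (card (U v N m)) * sqrt q ^ N)"
      using DU by (intro sum_mono sum_bounded_above) auto
    also have "\<dots> \<le> (\<Sum>m\<in>{..N}. (real (card E) + 1) ^ N * sqrt q ^ N)"
    proof (intro sum_mono mult_right_mono)
      fix m show "real (card (U v N m)) \<le> (real (card E) + 1) ^ N"
        using of_nat_mono[OF U(2)[of v N m], where ?'a = real] by (simp add: add.commute)
    qed (use q0 in auto)
    also have "\<dots> = real (N + 1) * ((real (card E) + 1) * sqrt q) ^ N"
      by (simp add: power_mult_distrib)
    also have "\<dots> \<le> 2 ^ N * (1 / 4) ^ N"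
    proof (intro mult_mono power_mono)
      have "N + 1 \<le> 2 ^ N" by (induction N) auto
      then show "real (N + 1) \<le> 2 ^ N" by (metis of_nat_le_iff of_nat_numeral of_nat_power)
    qed (use q0 in \<open>auto simp: algebra_simps\<close>)
    also have "\<dots> = (1 / 2) ^ N" by (simp add: power_mult_distrib[symmetric])
    finally show ?thesis .
  qed
  have "AE \<omega> in M. \<forall>v. \<forall>\<^sub>F N in sequentially. \<omega> \<in> space M - A v N"
  proof (rule AE_all_countable[THEN iffD2], rule allI)
    fix v
    have "summable (\<lambda>N. prob (A v N))"
      by (rule summable_comparison_test'[OF summable_geometric[of "1/2 :: real"]]) (use PA in auto)
    then show "AE \<omega> in M. \<forall>\<^sub>F N in sequentially. \<omega> \<in> space M - A v N"
      using borel_cantelli_AE1[of "A v" M] A by (simp add: emeasure_eq_measure)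
  qed
  then show ?thesis
  proof eventually_elim
    case (elim \<omega>)
    let ?c = "\<lambda>v m. \<omega> \<in> C v m"
    show ?case
    proof (rule lipschitz_surface_above_reach)
      fix v
      obtain N\<^sub>0 where N\<^sub>0: "\<And>N. N \<ge> N\<^sub>0 \<Longrightarrow> \<omega> \<in> space M - A v N"
        using elim by (auto simp: eventually_sequentially)
      have "\<not> reach E ?c N v m" if "m \<ge> N\<^sub>0" for m N
      proof
        assume "reach E ?c N v m"
        from reach_imp_many_closed[OF this] obtain N' S where
          "N' \<ge> m" "S \<in> U v N' m" "\<forall>(u, k)\<in>S. \<omega> \<in> C u k" by (auto simp: U_def)
        then have "\<omega> \<in> A v N'" using N\<^sub>0[of N\<^sub>0] by (auto simp: A_def D_def intro!: bexI[of _ m] bexI[of _ S])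
        with N\<^sub>0[of N'] \<open>N' \<ge> m\<close> that show False by auto
      qed
      then show "\<forall>\<^sub>F m in sequentially. \<forall>N. \<not> reach E ?c N v m"
        by (auto simp: eventually_sequentially)
    qed
  qed
qed

section \<open>Boxes without strong obstacles\<close>

lemma poisson_process_indep_counts:
  assumes "poisson_process M S l z"
    and "range B \<subseteq> sets borel" "\<And>j. B j \<subseteq> S" "\<And>j. emeasure lborel (B j) < \<infinity>" "disjoint_family (B :: nat \<Rightarrow> _)"
  shows "prob_space.indep_vars M (\<lambda>_. borel) (\<lambda>j. point_count z (B j)) UNIV"
  using assms(1)[unfolded poisson_process_def, THEN conjunct2, THEN conjunct2, THEN conjunct2,
    THEN spec, of B] assms(2-5) by simp

lemma poisson_process_count:
  assumes "poisson_process M S l z"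
    and "B \<in> sets borel" "B \<subseteq> S" "emeasure lborel B < \<infinity>"
  shows "measure M {\<omega>\<in>space M. point_count z B \<omega> = of_nat m}
    = (l * measure lborel B) ^ m / fact m * exp (- (l * measure lborel B))"
  using assms(1)[unfolded poisson_process_def, THEN conjunct2, THEN conjunct2, THEN conjunct1,
    THEN bspec, OF assms(2)] assms(3-4) by simp

lemma point_count_measurable:
  assumes "prob_space M" "poisson_process M S l z"
    and "B \<in> sets borel" "B \<subseteq> S" "emeasure lborel B < \<infinity>"
  shows "point_count z B \<in> borel_measurable M"
proof -
  define B' where "B' = (\<lambda>j::nat. if j = 0 then B else {})"
  have "prob_space.indep_vars M (\<lambda>_. borel) (\<lambda>j. point_count z (B' j)) UNIV"
    by (rule poisson_process_indep_counts[OF assms(2), where B = B'])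
      (use assms(3-5) in \<open>auto simp: B'_def disjoint_family_on_def split: if_splits\<close>)
  then have "point_count z (B' 0) \<in> borel_measurable M"
    by (simp add: prob_space.indep_vars_def2[OF assms(1)])
  then show ?thesis by (simp add: B'_def)
qed

text \<open>
  The Poisson weights sum to one, so almost surely a bounded set contains finitely many points.
\<close>

lemma poisson_process_locally_finite:
  fixes z :: "nat \<Rightarrow> '\<omega> \<Rightarrow> 'a::euclidean_space"
  assumes M: "prob_space M" and z: "poisson_process M S l z" and S: "S \<in> sets borel"
  shows "AE \<omega> in M. \<forall>r. finite {k. norm (z k \<omega>) \<le> r}"
proof -
  interpret prob_space M by fact
  have "AE \<omega> in M. \<forall>N::nat. finite {k. z k \<omega> \<in> cball 0 (real N) \<inter> S}"
  proof (rule AE_all_countable[THEN iffD2], rule allI)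
    fix N :: nat
    define B where "B = cball 0 (real N) \<inter> S"
    have "emeasure lborel B \<le> emeasure lborel (cball (0::'a) (real N))"
      unfolding B_def by (rule emeasure_mono) auto
    also have "\<dots> < \<infinity>" using emeasure_compact_finite[of "cball (0::'a) (real N)"] by simp
    finally have B: "B \<in> sets borel" "B \<subseteq> S" "emeasure lborel B < \<infinity>"
      using S by (auto simp: B_def)
    define v where "v = l * measure lborel B"
    define X where "X m = {\<omega>\<in>space M. point_count z B \<omega> = of_nat m}" for m :: nat
    have X: "X m \<in> events" for m
      unfolding X_def using point_count_measurable[OF M z B] by measurable
    have "(\<lambda>m. v ^ m / fact m * exp (- v)) sums (exp v * exp (- v))"
      using exp_converges[of v] by (intro sums_mult2) (simp add: divide_inverse scaleR_conv_of_real mult.commute)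
    moreover have "prob (X m) = v ^ m / fact m * exp (- v)" for m
      unfolding X_def v_def by (rule poisson_process_count[OF z B])
    ultimately have "(\<lambda>m. prob (X m)) sums 1" by (simp add: exp_minus)
    moreover have "(\<lambda>m. prob (X m)) sums prob (\<Union>m. X m)"
      using X by (intro finite_measure_UNION) (auto simp: disjoint_family_on_def X_def)
    ultimately have "prob (\<Union>m. X m) = 1" using sums_unique2 by blast
    then have "AE \<omega> in M. \<omega> \<in> (\<Union>m. X m)" by (rule AE_prob_1)
    then show "AE \<omega> in M. finite {k. z k \<omega> \<in> cball 0 (real N) \<inter> S}"
    proof eventually_elim
      case (elim \<omega>)
      then have "emeasure (count_space UNIV) {k. z k \<omega> \<in> B} \<noteq> \<infinity>"
        by (auto simp: X_def point_count_def)
      then show ?case unfolding B_def by (auto simp: emeasure_count_space split: if_splits)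
    qed
  qed
  with AE_space show ?thesis
  proof eventually_elim
    case (elim \<omega>)
    show ?case
    proof
      fix r
      obtain N :: nat where "r \<le> real N" using real_arch_simple by blast
      then have "{k. norm (z k \<omega>) \<le> r} \<subseteq> {k. z k \<omega> \<in> cball 0 (real N) \<inter> S}"
        using z elim(1) by (auto simp: poisson_process_def)
      then show "finite {k. norm (z k \<omega>) \<le> r}" using elim(2) finite_subset by blast
    qed
  qed
qed

text \<open>
  The independence in the definition of a Poisson process is stated for sequences of sets; a finite
  family is enumerated and continued by empty sets.
\<close>

lemma poisson_void_probability:
  assumes M: "prob_space M" and z: "poisson_process M S l z" and T: "finite T"
    and Q: "\<And>t. t \<in> T \<Longrightarrow> Q t \<in> sets borel" "\<And>t. t \<in> T \<Longrightarrow> Q t \<subseteq> S"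
      "\<And>t. t \<in> T \<Longrightarrow> emeasure lborel (Q t) < \<infinity>" "disjoint_family_on Q T"
  shows "measure M {\<omega>\<in>space M. \<forall>t\<in>T. \<forall>k. z k \<omega> \<notin> Q t} = (\<Prod>t\<in>T. exp (- (l * measure lborel (Q t))))"
proof (cases "T = {}")
  case True
  then show ?thesis using prob_space.prob_space[OF M] by simp
next
  case False
  interpret prob_space M by fact
  obtain g where g: "bij_betw g {..<card T} T"
    using ex_bij_betw_nat_finite[OF T] by (auto simp: atLeast0LessThan)
  define B where "B i = (if i < card T then Q (g i) else {})" for i
  have gT: "g i \<in> T" if "i < card T" for i using bij_betwE[OF g] that by auto
  have B: "range B \<subseteq> sets borel" "\<forall>i. B i \<subseteq> S" "\<forall>i. emeasure lborel (B i) < \<infinity>"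
    using Q(1-3) gT by (auto simp: B_def)
  have "disjoint_family B"
    unfolding disjoint_family_on_def
  proof (intro ballI impI)
    fix i j :: nat assume "i \<noteq> j"
    then have "Q (g i) \<inter> Q (g j) = {}" if "i < card T" "j < card T"
    proof -
      have "g i \<noteq> g j"
        using \<open>i \<noteq> j\<close> that inj_onD[OF bij_betw_imp_inj_on[OF g], of i j] by auto
      then show ?thesis
        using Q(4) gT[OF that(1)] gT[OF that(2)] unfolding disjoint_family_on_def by blast
    qed
    then show "B i \<inter> B j = {}" by (simp add: B_def)
  qed
  then have ind: "indep_vars (\<lambda>_. borel) (\<lambda>j. point_count z (B j)) UNIV"
    using B by (intro poisson_process_indep_counts[OF z, where B = B]) auto
  have "{\<omega>\<in>space M. \<forall>t\<in>T. \<forall>k. z k \<omega> \<notin> Q t} = (\<Inter>i\<in>{..<card T}. point_count z (B i) -` {0} \<inter> space M)"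
  proof -
    have "(\<forall>t\<in>T. \<forall>k. z k \<omega> \<notin> Q t) \<longleftrightarrow> (\<forall>i\<in>{..<card T}. \<forall>k. z k \<omega> \<notin> Q (g i))" for \<omega>
    proof -
      have "(\<forall>t\<in>g ` {..<card T}. \<forall>k. z k \<omega> \<notin> Q t) \<longleftrightarrow> (\<forall>i\<in>{..<card T}. \<forall>k. z k \<omega> \<notin> Q (g i))" by blast
      then show ?thesis unfolding bij_betw_imp_surj_on[OF g] .
    qed
    moreover have "B i = Q (g i)" if "i < card T" for i using that by (simp add: B_def)
    moreover have "{..<card T} \<noteq> {}" using False T by (simp add: lessThan_empty_iff)
    moreover have "point_count z (B i) \<omega> = 0 \<longleftrightarrow> (\<forall>k. z k \<omega> \<notin> B i)" for i \<omega>
      using emeasure_count_space_eq_0[of UNIV "{k. z k \<omega> \<in> B i}"] by (auto simp: point_count_def)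
    ultimately show ?thesis by (simp add: set_eq_iff) blast
  qed
  also have "prob \<dots> = (\<Prod>i\<in>{..<card T}. prob (point_count z (B i) -` {0} \<inter> space M))"
    using False T by (intro indep_varsD[OF ind]) (auto simp: lessThan_empty_iff)
  also have "\<dots> = (\<Prod>i\<in>{..<card T}. exp (- (l * measure lborel (B i))))"
  proof (rule prod.cong[OF refl])
    fix i
    have "B i \<in> sets borel" "B i \<subseteq> S" "emeasure lborel (B i) < \<infinity>" using B by auto
    from poisson_process_count[OF z this, of 0] show "prob (point_count z (B i) -` {0} \<inter> space M) = exp (- (l * measure lborel (B i)))"
      by (simp add: vimage_def Int_def conj_commute)
  qed
  also have "\<dots> = (\<Prod>i\<in>{..<card T}. exp (- (l * measure lborel (Q (g i)))))"
    by (intro prod.cong) (auto simp: B_def)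
  also have "\<dots> = (\<Prod>t\<in>T. exp (- (l * measure lborel (Q t))))"
    by (rule prod.reindex_bij_betw[OF g])
  finally show ?thesis .
qed

lemma no_strong_obstacle_measurable:
  assumes "obstacle_distribution M r\<^sub>1 l z s" and Q: "Q \<in> sets borel" and M: "prob_space M"
  shows "{\<omega>\<in>space M. \<forall>k. z k \<omega> \<in> Q \<longrightarrow> s k \<omega> < b} \<in> sets M"
proof -
  have [measurable]: "z k \<in> borel_measurable M" "s k \<in> borel_measurable M" for k
    using assms(1) by (simp_all add: obstacle_distribution_def poisson_process_def prob_space.indep_vars_def2[OF M])
  note [measurable] = Q
  show ?thesis by measurable
qed

text \<open>
  If no set \<open>Q t\<close> contains a strong obstacle, then for some \<open>K \<subseteq> T\<close> the sets with \<open>t \<in> T - K\<close> are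
  void, and for \<open>t \<in> K\<close> the first point in \<open>Q t\<close>, with index \<open>\<kappa> t\<close>, carries a strength below \<open>b\<close>. For
  fixed \<open>K\<close> and \<open>\<kappa>\<close>, the event \<open>A K \<kappa>\<close> concerning the points and the event \<open>B K \<kappa>\<close> concerning the
  strengths are independent. The indices \<open>\<kappa> t\<close> are distinct because the \<open>Q t\<close> are disjoint, so
  \<open>B K \<kappa>\<close> has probability at most \<open>\<epsilon> ^ card K\<close>. For different \<open>\<kappa>\<close> the events \<open>A K \<kappa>\<close> are disjoint and
  contained in the event that \<open>Q t\<close> is void for all \<open>t \<in> T - K\<close>. Summation over \<open>\<kappa>\<close> therefore gives
  \<open>\<epsilon> ^ card T\<close>, and summation over \<open>K\<close> the factor \<open>2 ^ card T\<close>.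
\<close>

lemma no_strong_obstacle_probability:
  fixes z :: "nat \<Rightarrow> '\<omega> \<Rightarrow> (real ^ 'n) \<times> real" and Q :: "'t \<Rightarrow> ((real ^ 'n) \<times> real) set"
  assumes M: "prob_space M" and obs: "obstacle_distribution M r\<^sub>1 l z s" and T: "finite T"
    and Q: "\<And>t. t \<in> T \<Longrightarrow> Q t \<in> sets borel" "\<And>t. t \<in> T \<Longrightarrow> Q t \<subseteq> UNIV \<times> {r\<^sub>1..}"
      "\<And>t. t \<in> T \<Longrightarrow> emeasure lborel (Q t) < \<infinity>" "disjoint_family_on Q T"
    and void: "\<And>t. t \<in> T \<Longrightarrow> exp (- (l * measure lborel (Q t))) \<le> \<epsilon>"
    and weak: "measure M {\<omega>\<in>space M. s 0 \<omega> < b} \<le> \<epsilon>"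
  shows "measure M {\<omega>\<in>space M. \<forall>t\<in>T. \<forall>k. z k \<omega> \<in> Q t \<longrightarrow> s k \<omega> < b} \<le> (2 * \<epsilon>) ^ card T"
proof -
  interpret prob_space M by fact
  have z: "poisson_process M (UNIV \<times> {r\<^sub>1..}) l z" and inds: "indep_vars (\<lambda>_. borel) s UNIV"
    and distr: "\<And>k. distr M borel (s k) = distr M borel (s 0)"
    and ind: "indep_set
       (sets (vimage_algebra (space M) (\<lambda>\<omega> k. s k \<omega>) (PiM UNIV (\<lambda>_. borel))))
       (sets (vimage_algebra (space M) (\<lambda>\<omega> k. z k \<omega>) (PiM UNIV (\<lambda>_. borel))))"
    using obs unfolding obstacle_distribution_def by blast+
  have zm[measurable]: "z k \<in> borel_measurable M" and sm[measurable]: "s k \<in> borel_measurable M" for k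
    using z inds by (simp_all add: poisson_process_def indep_vars_def2)
  note Qm = Q(1)
  have \<epsilon>: "0 \<le> \<epsilon>" using weak measure_nonneg order_trans by blast
  define V where "V = {\<omega>\<in>space M. \<forall>t\<in>T. \<forall>k. z k \<omega> \<in> Q t \<longrightarrow> s k \<omega> < b}"
  define A where "A K \<kappa> = {\<omega>\<in>space M. (\<forall>t\<in>T - K. \<forall>k. z k \<omega> \<notin> Q t) \<and>
      (\<forall>t\<in>K. z (\<kappa> t) \<omega> \<in> Q t \<and> (\<forall>k<\<kappa> t. z k \<omega> \<notin> Q t))}" for K and \<kappa> :: "'t \<Rightarrow> nat"
  define B where "B K \<kappa> = {\<omega>\<in>space M. \<forall>t\<in>K. s (\<kappa> t) \<omega> < b}" for K and \<kappa> :: "'t \<Rightarrow> nat"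
  \<comment> \<open>Extensional functions make the index set countable.\<close>
  let ?E = "\<lambda>K. \<Union>\<kappa>\<in>PiE K (\<lambda>_. UNIV). A K \<kappa> \<inter> B K \<kappa>"
  have cover: "V \<subseteq> (\<Union>K\<in>Pow T. ?E K)"
  proof
    fix \<omega> assume \<omega>: "\<omega> \<in> V"
    define K where "K = {t\<in>T. \<exists>k. z k \<omega> \<in> Q t}"
    define \<kappa> where "\<kappa> = (\<lambda>t\<in>K. LEAST k. z k \<omega> \<in> Q t)"
    have hit: "z (\<kappa> t) \<omega> \<in> Q t" if "t \<in> K" for t
      using that LeastI_ex[of "\<lambda>k. z k \<omega> \<in> Q t"] by (simp add: \<kappa>_def K_def)
    have first: "z k \<omega> \<notin> Q t" if "t \<in> K" "k < \<kappa> t" for t k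
      using that not_less_Least[of k "\<lambda>k. z k \<omega> \<in> Q t"] by (simp add: \<kappa>_def)
    have KT: "K \<subseteq> T" and void: "\<And>t k. t \<in> T - K \<Longrightarrow> z k \<omega> \<notin> Q t" by (auto simp: K_def)
    have \<omega>M: "\<omega> \<in> space M" and low: "\<And>t k. t \<in> T \<Longrightarrow> z k \<omega> \<in> Q t \<Longrightarrow> s k \<omega> < b"
      using \<omega> by (auto simp: V_def)
    have "\<omega> \<in> A K \<kappa>" unfolding A_def using \<omega>M hit first void by blast
    moreover have "\<omega> \<in> B K \<kappa>" unfolding B_def using \<omega>M low hit KT by blast
    moreover have "\<kappa> \<in> PiE K (\<lambda>_. UNIV)" by (simp add: \<kappa>_def)
    moreover have "K \<in> Pow T" using KT by blast
    ultimately show "\<omega> \<in> (\<Union>K\<in>Pow T. ?E K)" by blast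
  qed
  have Am: "A K \<kappa> \<in> events" and Bm: "B K \<kappa> \<in> events" if "K \<subseteq> T" for K \<kappa>
  proof -
    have [measurable]: "finite K" "finite (T - K)" using that T finite_subset by auto
    have [measurable]: "t \<in> T - K \<Longrightarrow> Q t \<in> sets borel" "t \<in> K \<Longrightarrow> Q t \<in> sets borel" for t
      using Qm that by auto
    show "A K \<kappa> \<in> events" "B K \<kappa> \<in> events"
      unfolding A_def B_def by measurable
  qed
  have cnt: "countable (PiE K (\<lambda>_. UNIV :: nat set))" if "K \<subseteq> T" for K
    using that T finite_subset by (intro countable_PiE) auto
  have E: "?E K \<in> events" if "K \<subseteq> T" for K
    using that Am Bm cnt by (intro sets.countable_UN') auto
  have AB: "prob (A K \<kappa> \<inter> B K \<kappa>) \<le> \<epsilon> ^ card K * prob (A K \<kappa>)" if K: "K \<subseteq> T" for K \<kappa>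
  proof (cases "A K \<kappa> = {}")
    case False
    then obtain \<omega> where "\<omega> \<in> A K \<kappa>" by blast
    then have hit: "z (\<kappa> t) \<omega> \<in> Q t" if "t \<in> K" for t using that by (simp add: A_def)
    have inj: "inj_on \<kappa> K"
    proof (intro inj_onI, rule ccontr)
      fix t t' assume t: "t \<in> K" "t' \<in> K" "\<kappa> t = \<kappa> t'" "t \<noteq> t'"
      then have "Q t \<inter> Q t' = {}" using Q(4) K unfolding disjoint_family_on_def by blast
      then show False using hit[OF t(1)] hit[OF t(2)] t(3) by auto
    qed
    have fK: "finite K" using K T finite_subset by auto
    have "prob (B K \<kappa>) \<le> \<epsilon> ^ card K"
    proof (cases "K = {}")
      case False
      have "B K \<kappa> = (\<Inter>k\<in>\<kappa> ` K. s k -` {..<b} \<inter> space M)"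
        using False by (auto simp: B_def)
      also have "prob \<dots> = (\<Prod>k\<in>\<kappa> ` K. prob (s k -` {..<b} \<inter> space M))"
        using False fK by (intro indep_varsD[OF inds]) auto
      also have "\<dots> \<le> (\<Prod>k\<in>\<kappa> ` K. \<epsilon>)"
      proof (intro prod_mono conjI measure_nonneg)
        fix k
        have "prob (s k -` {..<b} \<inter> space M) = measure (distr M borel (s k)) {..<b}"
          by (simp add: measure_distr)
        also have "\<dots> = measure (distr M borel (s 0)) {..<b}" by (simp only: distr[of k])
        also have "\<dots> = prob (s 0 -` {..<b} \<inter> space M)" by (simp add: measure_distr)
        also have "s 0 -` {..<b} \<inter> space M = {\<omega>\<in>space M. s 0 \<omega> < b}" by auto
        finally show "prob (s k -` {..<b} \<inter> space M) \<le> \<epsilon>" using weak by simp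
      qed
      also have "\<dots> = \<epsilon> ^ card K" using inj by (simp add: card_image)
      finally show ?thesis .
    qed simp
    moreover have "prob (B K \<kappa> \<inter> A K \<kappa>) = prob (B K \<kappa>) * prob (A K \<kappa>)"
    proof (rule indep_setD[OF ind])
      define N where "N = vimage_algebra (space M) (\<lambda>\<omega> k. s k \<omega>) (PiM UNIV (\<lambda>_. borel :: real measure))"
      have sp: "space N = space M" by (simp add: N_def)
      have "(\<lambda>\<omega> k. s k \<omega>) \<in> measurable N (PiM UNIV (\<lambda>_. borel))"
        unfolding N_def by (rule measurable_vimage_algebra1) (auto simp: space_PiM)
      from measurable_compose[OF this measurable_component_singleton]
      have [measurable]: "s k \<in> borel_measurable N" for k by simp
      have "{\<omega>\<in>space N. \<forall>t\<in>K. s (\<kappa> t) \<omega> < b} \<in> sets N"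
        using fK by measurable
      then show "B K \<kappa> \<in> sets (vimage_algebra (space M) (\<lambda>\<omega> k. s k \<omega>) (PiM UNIV (\<lambda>_. borel)))"
        by (simp only: B_def N_def[symmetric] sp)
    next
      define N where "N = vimage_algebra (space M) (\<lambda>\<omega> k. z k \<omega>) (PiM UNIV (\<lambda>_. borel :: ((real ^ 'n) \<times> real) measure))"
      have sp: "space N = space M" by (simp add: N_def)
      have "(\<lambda>\<omega> k. z k \<omega>) \<in> measurable N (PiM UNIV (\<lambda>_. borel))"
        unfolding N_def by (rule measurable_vimage_algebra1) (auto simp: space_PiM)
      from measurable_compose[OF this measurable_component_singleton]
      have [measurable]: "z k \<in> borel_measurable N" for k by simp
      have [measurable]: "t \<in> T - K \<Longrightarrow> Q t \<in> sets borel" "t \<in> K \<Longrightarrow> Q t \<in> sets borel" for t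
        using Qm K by auto
      have [measurable]: "finite K" "finite (T - K)" using fK T by auto
      have "{\<omega>\<in>space N. (\<forall>t\<in>T - K. \<forall>k. z k \<omega> \<notin> Q t) \<and>
        (\<forall>t\<in>K. z (\<kappa> t) \<omega> \<in> Q t \<and> (\<forall>k<\<kappa> t. z k \<omega> \<notin> Q t))} \<in> sets N"
        by measurable
      then show "A K \<kappa> \<in> sets (vimage_algebra (space M) (\<lambda>\<omega> k. z k \<omega>) (PiM UNIV (\<lambda>_. borel)))"
        by (simp only: A_def N_def[symmetric] sp)
    qed
    ultimately show ?thesis by (simp add: Int_commute mult_right_mono)
  qed simp
  have PE: "prob (?E K) \<le> \<epsilon> ^ card T" if K: "K \<subseteq> T" for K
  proof -
    let ?I = "PiE K (\<lambda>_. UNIV :: nat set)"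
    have disj: "disjoint_family_on (A K) ?I"
      unfolding disjoint_family_on_def
    proof (intro ballI impI, rule ccontr)
      fix \<kappa> \<kappa>' assume \<kappa>: "\<kappa> \<in> ?I" "\<kappa>' \<in> ?I" "\<kappa> \<noteq> \<kappa>'" "A K \<kappa> \<inter> A K \<kappa>' \<noteq> {}"
      then obtain \<omega> where \<omega>: "\<omega> \<in> A K \<kappa>" "\<omega> \<in> A K \<kappa>'" by blast
      have "\<kappa> t = \<kappa>' t" if "t \<in> K" for t
      proof (rule linorder_cases[of "\<kappa> t" "\<kappa>' t"])
        assume "\<kappa> t < \<kappa>' t" then show ?thesis using \<omega> that unfolding A_def by blast
      next
        assume "\<kappa>' t < \<kappa> t" then show ?thesis using \<omega> that unfolding A_def by blast
      qed
      then have "\<kappa> = \<kappa>'" using \<kappa>(1,2) by (intro PiE_ext)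
      with \<kappa>(3) show False ..
    qed
    have "emeasure M (?E K) = (\<integral>\<^sup>+\<kappa>. emeasure M (A K \<kappa> \<inter> B K \<kappa>) \<partial>count_space ?I)"
      using disj K Am Bm cnt by (intro emeasure_UN_countable) (auto simp: disjoint_family_on_def)
    also have "\<dots> \<le> (\<integral>\<^sup>+\<kappa>. ennreal (\<epsilon> ^ card K) * emeasure M (A K \<kappa>) \<partial>count_space ?I)"
      using AB[OF K] \<epsilon> by (intro nn_integral_mono) (simp add: emeasure_eq_measure ennreal_mult[symmetric])
    also have "\<dots> = ennreal (\<epsilon> ^ card K) * (\<integral>\<^sup>+\<kappa>. emeasure M (A K \<kappa>) \<partial>count_space ?I)"
      by (rule nn_integral_cmult) simp
    also have "(\<integral>\<^sup>+\<kappa>. emeasure M (A K \<kappa>) \<partial>count_space ?I) = emeasure M (\<Union>\<kappa>\<in>?I. A K \<kappa>)"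
      using disj K Am cnt by (intro emeasure_UN_countable[symmetric]) auto
    also have "\<dots> \<le> emeasure M {\<omega>\<in>space M. \<forall>t\<in>T - K. \<forall>k. z k \<omega> \<notin> Q t}"
    proof (rule emeasure_mono)
      have [measurable]: "finite (T - K)" using T by auto
      have [measurable]: "t \<in> T - K \<Longrightarrow> Q t \<in> sets borel" for t using Qm by auto
      show "{\<omega>\<in>space M. \<forall>t\<in>T - K. \<forall>k. z k \<omega> \<notin> Q t} \<in> events" by measurable
    qed (auto simp: A_def)
    also have "\<dots> = ennreal (\<Prod>t\<in>T - K. exp (- (l * measure lborel (Q t))))"
      unfolding emeasure_eq_measure
      by (subst poisson_void_probability[OF M z]) (use T Q in \<open>auto simp: disjoint_family_on_def\<close>)
    also have "\<dots> \<le> ennreal (\<Prod>t\<in>T - K. \<epsilon>)"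
      using void by (intro ennreal_leI prod_mono) auto
    also have "ennreal (\<epsilon> ^ card K) * ennreal (\<Prod>t\<in>T - K. \<epsilon>) = ennreal (\<epsilon> ^ (card K + card (T - K)))"
      using \<epsilon> by (simp add: ennreal_mult[symmetric] power_add)
    also have "card K + card (T - K) = card T"
      using K T by (metis card_Diff_subset card_mono finite_subset le_add_diff_inverse)
    finally show ?thesis using \<epsilon> by (simp add: emeasure_eq_measure mult_left_mono)
  qed
  have EP: "K \<in> Pow T \<Longrightarrow> ?E K \<in> events" for K using E by blast
  have "finite (Pow T)" using T by blast
  have "prob V \<le> prob (\<Union>K\<in>Pow T. ?E K)"
    by (rule finite_measure_mono[OF cover sets.finite_UN[OF \<open>finite (Pow T)\<close> EP]])
  also have "\<dots> \<le> (\<Sum>K\<in>Pow T. prob (?E K))"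
    by (rule finite_measure_subadditive_finite[OF \<open>finite (Pow T)\<close> image_subsetI[OF EP]])
  also have "\<dots> \<le> (\<Sum>K\<in>Pow T. \<epsilon> ^ card T)" using PE by (intro sum_mono) auto
  also have "\<dots> = (2 * \<epsilon>) ^ card T" using T by (simp add: card_Pow power_mult_distrib)
  finally show ?thesis unfolding V_def .
qed

section \<open>Lattice boxes\<close>

lemma finite_int_cube: "finite {v :: int ^ 'n. \<forall>i. \<bar>v $ i\<bar> \<le> N}"
proof (rule finite_subset)
  show "{v :: int ^ 'n. \<forall>i. \<bar>v $ i\<bar> \<le> N} \<subseteq> vec_lambda ` (PiE UNIV (\<lambda>_. {- N..N}))"
  proof
    fix v :: "int ^ 'n" assume "v \<in> {v. \<forall>i. \<bar>v $ i\<bar> \<le> N}"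
    then have "vec_nth v \<in> PiE UNIV (\<lambda>_. {- N..N})" by (auto simp: abs_le_iff minus_le_iff)
    then have "vec_lambda (vec_nth v) \<in> vec_lambda ` (PiE UNIV (\<lambda>_. {- N..N}))" by (rule imageI)
    then show "v \<in> vec_lambda ` (PiE UNIV (\<lambda>_. {- N..N}))" by simp
  qed
qed (auto intro!: finite_PiE)

text \<open>
  The columns are indexed by \<open>v\<close> and the boxes in a column by \<open>m\<close>; the lowest ones stand on the plane
  at height \<open>r\<close>. Boxes are open, so that different ones are disjoint.
\<close>

definition lattice_box :: "real \<Rightarrow> real \<Rightarrow> real \<Rightarrow> int ^ 'n \<Rightarrow> nat \<Rightarrow> ((real ^ 'n) \<times> real) set" where
  "lattice_box d h r v m =
     box (\<chi> i. d * of_int (v $ i), r + h * of_nat m) (\<chi> i. d * (of_int (v $ i) + 1), r + h * (of_nat m + 1))"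

lemma mem_lattice_box:
  "(x, y) \<in> lattice_box d h r v m \<longleftrightarrow>
    (\<forall>i. d * of_int (v $ i) < x $ i \<and> x $ i < d * (of_int (v $ i) + 1)) \<and>
    r + h * of_nat m < y \<and> y < r + h * (of_nat m + 1)"
proof -
  have "lattice_box d h r v m = box (\<chi> i. d * of_int (v $ i)) (\<chi> i. d * (of_int (v $ i) + 1))
      \<times> box (r + h * of_nat m) (r + h * (of_nat m + 1))"
    unfolding lattice_box_def by (auto simp: box_def Basis_prod_def ball_Un)
  then show ?thesis by (simp add: mem_box_cart)
qed

lemma measure_lattice_box:
  assumes "d > 0" "h > 0"
  shows "measure lborel (lattice_box d h r (v :: int ^ 'n) m) = d ^ CARD('n) * h"
proof -
  let ?w = "(\<chi> i. d * (of_int (v $ i) + 1), r + h * (of_nat m + 1)) - (\<chi> i. d * of_int (v $ i), r + h * of_nat m) :: (real ^ 'n) \<times> real"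
  have w: "?w = ((\<chi> i. d), h)" by (simp add: vec_eq_iff algebra_simps)
  have vec: "(\<chi> i. d) \<bullet> b = d" if "b \<in> Basis" for b :: "real ^ 'n"
    using that by (auto simp: Basis_vec_def inner_axis)
  have "measure lborel (lattice_box d h r v m) = (\<Prod>b\<in>Basis. ?w \<bullet> b)"
    unfolding lattice_box_def
  proof (rule measure_lborel_box)
    fix b :: "(real ^ 'n) \<times> real" assume b: "b \<in> Basis"
    have "0 \<le> ?w \<bullet> b" unfolding w using b vec assms by (auto simp: Basis_prod_def)
    then show "(\<chi> i. d * of_int (v $ i), r + h * of_nat m) \<bullet> b \<le> (\<chi> i. d * (of_int (v $ i) + 1), r + h * (of_nat m + 1)) \<bullet> b"
      by (simp only: inner_diff_left diff_ge_0_iff_ge)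
  qed
  also have "\<dots> = (\<Prod>b\<in>(\<lambda>u. (u, 0)) ` (Basis :: (real ^ 'n) set) \<union> (\<lambda>u. (0, u)) ` (Basis :: real set). ((\<chi> i. d), h) \<bullet> b)"
    unfolding w Basis_prod_def ..
  also have "\<dots> = (\<Prod>b\<in>(\<lambda>u. (u, 0)) ` (Basis :: (real ^ 'n) set). ((\<chi> i. d), h :: real) \<bullet> b) * (\<Prod>b\<in>(\<lambda>u. (0 :: real ^ 'n, u)) ` (Basis :: real set). ((\<chi> i. d), h) \<bullet> b)"
    by (rule prod.union_disjoint) auto
  also have "\<dots> = (\<Prod>b\<in>(Basis :: (real ^ 'n) set). d) * h"
    by (subst prod.reindex) (auto simp: inj_on_def vec intro!: prod.cong)
  finally show ?thesis by simp
qed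

lemma lattice_box_disjoint:
  assumes "d > 0" "h > 0" "p \<in> lattice_box d h r v m" "p \<in> lattice_box d h r v' m'"
  shows "v = v' \<and> m = m'"
proof -
  obtain x y where p: "p = (x, y)" by (cases p)
  have eq: "c = \<lfloor>t / e\<rfloor>" if "e > 0" "e * of_int c < t" "t < e * (of_int c + 1)" for e t :: real and c
    using that by (intro floor_unique[symmetric]) (auto simp: field_simps)
  have "v $ i = v' $ i" for i
    using eq[OF assms(1), of "v $ i" "x $ i"] eq[OF assms(1), of "v' $ i" "x $ i"] assms(3,4)
    by (simp add: p mem_lattice_box)
  moreover have "int m = int m'"
    using eq[OF assms(2), of "int m" "y - r"] eq[OF assms(2), of "int m'" "y - r"] assms(3,4)
    by (simp add: p mem_lattice_box less_diff_eq diff_less_eq add.commute)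
  ultimately show ?thesis by (simp add: vec_eq_iff)
qed

section \<open>The obstacle field\<close>

text \<open>
  Since the centres do not accumulate and \<open>\<phi>\<close> has compact support, the series is a finite sum of
  nonpositive terms, hence bounded by each of them.
\<close>

lemma obstacle_field_le:
  assumes shape: "obstacle_shape \<phi> r\<^sub>0 r\<^sub>1" and s: "\<And>k. 0 \<le> s k \<omega>"
    and fin: "\<And>r. finite {k. norm (z k \<omega>) \<le> r}"
  shows "obstacle_field \<phi> z s \<omega> x y \<le> s k \<omega> * \<phi> ((x, y) - z k \<omega>)"
proof -
  let ?f = "\<lambda>k. s k \<omega> * \<phi> ((x, y) - z k \<omega>)"
  define N where "N = insert k {k. norm (z k \<omega>) \<le> norm (x, y) + r\<^sub>1}"
  have N: "finite N" "k \<in> N" using fin by (auto simp: N_def)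
  have \<phi>: "\<phi> p \<le> 0" "norm p > r\<^sub>1 \<Longrightarrow> \<phi> p = 0" for p
    using shape unfolding obstacle_shape_def by blast+
  have neg: "?f j \<le> 0" for j
    using s \<phi>(1) by (rule mult_nonneg_nonpos)
  have "?f j = 0" if "j \<notin> N" for j
  proof -
    have "norm (z j \<omega>) \<le> norm ((x, y) - z j \<omega>) + norm (x, y)"
      using norm_triangle_sub[of "z j \<omega>" "(x, y)"] by (simp add: norm_minus_commute)
    then have "norm ((x, y) - z j \<omega>) > r\<^sub>1" using that by (simp add: N_def)
    then show ?thesis by (simp add: \<phi>(2))
  qed
  then have "obstacle_field \<phi> z s \<omega> x y = (\<Sum>j\<in>N. ?f j)"
    unfolding obstacle_field_def by (rule suminf_finite[OF N(1)])
  also have "\<dots> = ?f k + (\<Sum>j\<in>N - {k}. ?f j)" by (rule sum.remove[OF N])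
  also have "\<dots> \<le> ?f k" using neg by (simp add: sum_nonpos)
  finally show ?thesis .
qed

lemma infnorm_pair_le:
  fixes u :: "real ^ 'n"
  assumes "norm u \<le> r" "\<bar>t\<bar> \<le> r"
  shows "infnorm (u, t) \<le> r"
proof -
  have "\<bar>(u, t) \<bullet> b\<bar> \<le> r" if "b \<in> Basis" for b
    using that assms Basis_le_norm[of _ u] by (fastforce simp: Basis_prod_def)
  then show ?thesis unfolding infnorm_Max by (intro Max.boundedI) auto
qed

lemma exists_strength_threshold:
  assumes "prob_space M" "s \<in> borel_measurable M" "AE \<omega> in M. s \<omega> > 0" "\<epsilon> > (0::real)"
  shows "\<exists>b>0. measure M {\<omega>\<in>space M. s \<omega> < (b::real)} \<le> \<epsilon>"
proof -
  interpret prob_space M by fact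
  note [measurable] = assms(2)
  define A where "A i = {\<omega>\<in>space M. s \<omega> < 1 / real (Suc i)}" for i
  have A: "range A \<subseteq> events" by (auto simp: A_def)
  have "decseq A"
    unfolding A_def decseq_def by (auto intro: less_le_trans simp: frac_le)
  then have "(\<lambda>i. prob (A i)) \<longlonglongrightarrow> prob (\<Inter>i. A i)"
    by (rule finite_Lim_measure_decseq[OF A])
  moreover have "prob (\<Inter>i. A i) = 0"
  proof (rule prob_eq_0[THEN iffD2])
    show "(\<Inter>i. A i) \<in> events" using A by (intro sets.countable_INT) auto
    show "AE \<omega> in M. \<omega> \<notin> (\<Inter>i. A i)"
      using assms(3)
    proof eventually_elim
      case (elim \<omega>)
      then obtain i where "inverse (real (Suc i)) < s \<omega>" using reals_Archimedean by blast
      then have "\<omega> \<notin> A i" by (simp add: A_def inverse_eq_divide)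
      then show ?case by blast
    qed
  qed
  ultimately have "\<forall>\<^sub>F i in sequentially. prob (A i) < \<epsilon>"
    using assms(4) by (simp add: order_tendstoD(2))
  then obtain i where "prob (A i) < \<epsilon>" by (auto simp: eventually_sequentially)
  then show ?thesis unfolding A_def by (intro exI[of _ "1 / real (Suc i)"]) auto
qed

section \<open>The supersolution over a Lipschitz surface of obstacles\<close>

text \<open>
  Between the radii \<open>n d\<close> and \<open>2 n d\<close> the barrier rises by \<open>c * d powr (1/2 - n)\<close>, while boxes of volume
  \<open>C\<close> have height \<open>C / d powr n\<close>. The quotient grows like \<open>sqrt d\<close>, so a large \<open>d\<close> works.
\<close>

lemma exists_cell_size:
  fixes a q\<^sub>0 C n r :: real
  defines "\<beta> \<equiv> (n - 1 / 2) / 2"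
  assumes "a > 0" "q\<^sub>0 > 0" "C > 0" "n \<ge> 1"
  shows "\<exists>d>0. 2 * (C / d powr n) + profile a q\<^sub>0 \<beta> ((n * d)\<^sup>2) \<le> profile a q\<^sub>0 \<beta> ((2 * n * d)\<^sup>2)"
proof -
  have \<beta>: "\<beta> > 0" using assms(5) by (simp add: \<beta>_def)
  define c where "c = a * q\<^sub>0 / \<beta> * (n\<^sup>2 / q\<^sub>0) powr - \<beta> * (1 - 4 powr - \<beta>)"
  have "4 powr - \<beta> < 4 powr (0::real)" using \<beta> by (intro powr_less_mono) auto
  then have c: "c > 0" using assms \<beta> by (simp add: c_def)
  \<comment> \<open>The first bound puts the radii outside the core, the second one makes \<open>c * sqrt d \<ge> 2 * C\<close>.\<close>
  define d where "d = max (sqrt q\<^sub>0) ((2 * C / c)\<^sup>2)"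
  have d: "d > 0" "d \<ge> sqrt q\<^sub>0" "d \<ge> (2 * C / c)\<^sup>2" using assms(3) by (auto simp: d_def less_max_iff_disj)
  have "sqrt q\<^sub>0 * 1 \<le> d * n" using d assms by (intro mult_mono) auto
  then have "(sqrt q\<^sub>0)\<^sup>2 \<le> (n * d)\<^sup>2" using assms by (intro power_mono) (auto simp: mult.commute)
  then have q1: "q\<^sub>0 \<le> (n * d)\<^sup>2" using assms by simp
  have q2: "q\<^sub>0 \<le> (2 * n * d)\<^sup>2" proof (rule order_trans[OF q1])
    show "(n * d)\<^sup>2 \<le> (2 * n * d)\<^sup>2" using assms d by (intro power_mono) auto
  qed
  define D where "D = d powr (- 2 * \<beta>)"
  have split: "(n\<^sup>2 * d\<^sup>2 / q\<^sub>0) powr - \<beta> = (n\<^sup>2 / q\<^sub>0) powr - \<beta> * D"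
  proof -
    have "(d\<^sup>2) powr - \<beta> = D" using d by (simp add: D_def powr_powr flip: powr_numeral)
    moreover have "(n\<^sup>2 * d\<^sup>2 / q\<^sub>0) powr - \<beta> = (n\<^sup>2 / q\<^sub>0) powr - \<beta> * (d\<^sup>2) powr - \<beta>"
      using assms by (subst powr_mult[symmetric]) (auto simp: mult_ac)
    ultimately show ?thesis by simp
  qed
  have split2: "((2 * n * d)\<^sup>2 / q\<^sub>0) powr - \<beta> = 4 powr - \<beta> * ((n\<^sup>2 / q\<^sub>0) powr - \<beta> * D)"
  proof -
    have "(2 * n * d)\<^sup>2 / q\<^sub>0 = 4 * (n\<^sup>2 * d\<^sup>2 / q\<^sub>0)" by (simp add: power_mult_distrib)
    then show ?thesis unfolding split[symmetric] using assms(3) by (simp only: powr_mult)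
  qed
  have diff: "profile a q\<^sub>0 \<beta> ((2 * n * d)\<^sup>2) - profile a q\<^sub>0 \<beta> ((n * d)\<^sup>2) = c * D"
    unfolding profile_outer[OF assms(3) q1] profile_outer[OF assms(3) q2] split2
    unfolding power_mult_distrib split
    by (simp add: c_def algebra_simps diff_divide_distrib)
  have "D * d powr n = sqrt d"
    using d by (simp add: D_def \<beta>_def powr_add[symmetric] powr_half_sqrt field_simps)
  moreover have "2 * C \<le> c * sqrt d"
  proof -
    have "2 * C / c \<le> sqrt d" using d(3) by (rule real_le_rsqrt)
    then show ?thesis using c by (simp add: field_simps)
  qed
  ultimately have "2 * C \<le> c * D * d powr n" by (simp add: mult.assoc)
  then have "2 * (C / d powr n) \<le> c * D" using d by (simp add: field_simps)
  with diff d(1) show ?thesis by (intro exI[of _ d]) simp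
qed

lemma lattice_point_near:
  fixes x p :: "real ^ 'n" and v :: "int ^ 'n"
  assumes d: "d > 0" and v: "\<And>i. v $ i = \<lfloor>x $ i / d\<rfloor>"
    and p: "\<And>i. d * of_int (v $ i) < p $ i" "\<And>i. p $ i < d * (of_int (v $ i) + 1)"
  shows "norm (x - p) \<le> real CARD('n) * d"
proof -
  have "\<bar>(x - p) $ i\<bar> \<le> d" for i
  proof -
    have "of_int (v $ i) \<le> x $ i / d" "x $ i / d < of_int (v $ i) + 1"
      unfolding v by linarith+
    then have "d * of_int (v $ i) \<le> x $ i" "x $ i < d * (of_int (v $ i) + 1)"
      using d by (auto simp: field_simps)
    then show ?thesis using p[of i] by (simp add: abs_le_iff algebra_simps)
  qed
  then have "(\<Sum>i\<in>UNIV. \<bar>(x - p) $ i\<bar>) \<le> (\<Sum>i\<in>(UNIV :: 'n set). d)" by (intro sum_mono) auto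
  then show ?thesis using norm_le_l1_cart[of "x - p"] by simp
qed

lemma cell_index_close:
  fixes x t p d c :: real and j :: int
  assumes d: "d > 0" and p: "d * of_int j < p" "p < d * (of_int j + 1)" and c: "\<bar>x - p\<bar> \<le> c * d"
  shows "of_int \<bar>j - \<lfloor>x / d\<rfloor>\<bar> \<le> c + 1"
proof -
  have "of_int j < p / d" "p / d < of_int j + 1" using p d by (auto simp: field_simps)
  moreover have "x / d - p / d \<le> c" "p / d - x / d \<le> c"
    using c d by (auto simp: field_simps abs_le_iff)
  moreover have "of_int \<lfloor>x / d\<rfloor> \<le> x / d" "x / d < of_int \<lfloor>x / d\<rfloor> + 1" by linarith+
  ultimately show ?thesis by (simp add: abs_le_iff) linarith
qed

lemma finite_lattice_points_near:
  fixes X :: "int ^ 'n \<Rightarrow> real ^ 'n"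
  assumes d: "d > 0" and X: "\<And>v i. d * of_int (v $ i) < X v $ i \<and> X v $ i < d * (of_int (v $ i) + 1)"
  shows "finite {v. norm (x - X v) \<le> r}"
proof (rule finite_subset[OF _ finite_int_cube])
  let ?N = "\<lceil>(r + norm x) / d + 1\<rceil>"
  show "{v. norm (x - X v) \<le> r} \<subseteq> {v. \<forall>i. \<bar>v $ i\<bar> \<le> ?N}"
  proof (intro subsetI CollectI allI)
    fix v i assume "v \<in> {v. norm (x - X v) \<le> r}"
    then have "norm (x - X v) \<le> r" by simp
    then have "norm (X v) \<le> r + norm x"
      using norm_triangle_sub[of "X v" x] by (simp add: norm_minus_commute)
    \<comment> \<open>The origin lies in the cell with index \<open>0\<close>.\<close>
    then have "\<bar>0 - X v $ i\<bar> \<le> (r + norm x) / d * d"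
      using component_le_norm_cart[of "X v" i] d by simp
    from cell_index_close[OF d _ _ this, of "v $ i"] X[of v i]
    have "of_int \<bar>v $ i\<bar> \<le> (r + norm x) / d + 1" by simp
    then show "\<bar>v $ i\<bar> \<le> ?N" by linarith
  qed
qed

text \<open>
  A point \<open>x\<close> lies in the column of a centre at distance at most \<open>n d\<close>. A centre at distance exactly
  \<open>2 n d\<close> lies in a column whose index differs by at most \<open>2 n + 1\<close> in each coordinate, so its height
  is less than \<open>2 h\<close> lower: one box for the Lipschitz condition and one for the position inside
  the boxes. By \<open>gap\<close>, the rise of the barrier outweighs this.
\<close>

lemma lipschitz_surface_supersolution:
  fixes f :: "real ^ 'n \<Rightarrow> real \<Rightarrow> real" and X :: "int ^ 'n \<Rightarrow> real ^ 'n"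
  defines "n \<equiv> real CARD('n)"
  defines "\<beta> \<equiv> (n - 1 / 2) / 2"
  assumes a: "a > 0" "8 * a\<^sup>2 * q\<^sub>0 * n \<le> 1" and q0: "q\<^sub>0 > 0"
    and d: "d > 0" and h: "h > 0"
    and gap: "2 * h + profile a q\<^sub>0 \<beta> ((n * d)\<^sup>2) \<le> profile a q\<^sub>0 \<beta> ((2 * n * d)\<^sup>2)"
    and F: "F \<le> a / n * ((2 * n * d)\<^sup>2 / q\<^sub>0) powr (- \<beta> - 1)"
    and box: "\<And>v. (X v, Y v) \<in> lattice_box d h r v (\<Lambda> v)"
    and lip: "\<And>v e. (\<forall>i. \<bar>e $ i\<bar> \<le> 2 * int CARD('n) + 1) \<Longrightarrow> \<Lambda> v \<le> Suc (\<Lambda> (v + e))"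
    and f_le: "\<And>x y. f x y \<le> 0"
    and f_core: "\<And>x v. (norm (x - X v))\<^sup>2 \<le> q\<^sub>0 \<Longrightarrow> f x (Y v + a * (norm (x - X v))\<^sup>2) \<le> - (2 * a + F)"
  shows "stationary_supersolution f F (barrier_min a q\<^sub>0 \<beta> (2 * n * d) X Y)"
    and "r \<ge> 0 \<Longrightarrow> 0 \<le> barrier_min a q\<^sub>0 \<beta> (2 * n * d) X Y x"
proof -
  have n: "n \<ge> 1" by (simp add: n_def Suc_le_eq)
  then have \<beta>: "\<beta> > 0" by (simp add: \<beta>_def)
  have X: "d * of_int (v $ i) < X v $ i \<and> X v $ i < d * (of_int (v $ i) + 1)" for v i
    using box[of v] by (simp add: mem_lattice_box)
  have Y: "r + h * of_nat (\<Lambda> v) < Y v" "Y v < r + h * (of_nat (\<Lambda> v) + 1)" for v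
    using box[of v] by (simp_all add: mem_lattice_box)
  have fin: "finite {v. norm (x - X v) \<le> r}" for x r
    using finite_lattice_points_near[OF d, of X] X by blast
  define c :: "real ^ 'n \<Rightarrow> int ^ 'n" where "c x = (\<chi> i. \<lfloor>x $ i / d\<rfloor>)" for x
  have near: "norm (x - X (c x)) \<le> n * d" for x
    unfolding n_def using X[of "c x"] by (intro lattice_point_near[OF d, of "c x"]) (auto simp: c_def)
  have nd: "n * d \<le> 2 * n * d" using n d by simp
  have inner: "\<exists>i. norm (x - X i) \<le> 2 * n * d \<and> (\<forall>j. norm (x - X j) = 2 * n * d \<longrightarrow>
        Y i + profile a q\<^sub>0 \<beta> ((norm (x - X i))\<^sup>2) < Y j + profile a q\<^sub>0 \<beta> ((2 * n * d)\<^sup>2))" for x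
  proof (intro exI[of _ "c x"] conjI allI impI)
    show "norm (x - X (c x)) \<le> 2 * n * d" using near[of x] nd by linarith
    fix j assume j: "norm (x - X j) = 2 * n * d"
    have "\<bar>(j - c x) $ i\<bar> \<le> 2 * int CARD('n) + 1" for i
    proof -
      have "\<bar>x $ i - X j $ i\<bar> \<le> 2 * n * d" using component_le_norm_cart[of "x - X j" i] j by simp
      from cell_index_close[OF d _ _ this, of "j $ i"] X[of j i]
      have "of_int \<bar>j $ i - c x $ i\<bar> \<le> 2 * n + 1" by (simp add: c_def)
      also have "2 * n + 1 = of_int (2 * int CARD('n) + 1)" by (simp add: n_def)
      finally show ?thesis unfolding of_int_le_iff by simp
    qed
    then have "\<Lambda> (c x) \<le> Suc (\<Lambda> (c x + (j - c x)))" by (intro lip) blast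
    then have "real (\<Lambda> (c x)) \<le> real (\<Lambda> j) + 1" by simp
    then have "h * real (\<Lambda> (c x)) \<le> h * (real (\<Lambda> j) + 1)" using h by (intro mult_left_mono) auto
    then have "Y (c x) < Y j + 2 * h" using Y(1)[of j] Y(2)[of "c x"] by (simp add: algebra_simps)
    moreover have "profile a q\<^sub>0 \<beta> ((norm (x - X (c x)))\<^sup>2) \<le> profile a q\<^sub>0 \<beta> ((n * d)\<^sup>2)"
      using near[of x] by (intro profile_mono a q0 \<beta> power_mono) auto
    ultimately show "Y (c x) + profile a q\<^sub>0 \<beta> ((norm (x - X (c x)))\<^sup>2) < Y j + profile a q\<^sub>0 \<beta> ((2 * n * d)\<^sup>2)"
      using gap by linarith
  qed
  show "stationary_supersolution f F (barrier_min a q\<^sub>0 \<beta> (2 * n * d) X Y)"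
    using barrier_min_supersolution[where X = X and Y = Y and f = f and R = "2 * real CARD('n) * d", OF a(1) a(2)[unfolded n_def] q0 fin inner[unfolded \<beta>_def n_def] f_le f_core F[unfolded \<beta>_def n_def]]
    by (simp add: \<beta>_def n_def)
  show "0 \<le> barrier_min a q\<^sub>0 \<beta> (2 * n * d) X Y x" if r: "r \<ge> 0"
  proof -
    have "barrier_min a q\<^sub>0 \<beta> (2 * n * d) X Y x \<in> (\<lambda>j. Y j + profile a q\<^sub>0 \<beta> ((norm (x - X j))\<^sup>2)) ` {j. norm (x - X j) \<le> 2 * n * d}"
      unfolding barrier_min_def using inner[of x] fin by (intro Min_in) auto
    then obtain j where j: "barrier_min a q\<^sub>0 \<beta> (2 * n * d) X Y x = Y j + profile a q\<^sub>0 \<beta> ((norm (x - X j))\<^sup>2)" by blast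
    have "0 \<le> r + h * of_nat (\<Lambda> j)" using r h by simp
    then have "0 \<le> Y j" using Y(1)[of j] by linarith
    then show ?thesis unfolding j using a q0 \<beta> by (intro add_nonneg_nonneg profile_nonneg) auto
  qed
qed

section \<open>Existence of the supersolution\<close>

text \<open>
  This is Lipschitz percolation with the boxes without strong obstacle as closed sites. The index of
  a strong obstacle in the box over \<open>v\<close> on the surface is \<open>k v\<close>.
\<close>

lemma strong_obstacle_surface:
  fixes z :: "nat \<Rightarrow> '\<omega> \<Rightarrow> (real ^ 'n) \<times> real" and E :: "(int ^ 'n) set"
  assumes M: "prob_space M" and obs: "obstacle_distribution M r\<^sub>1 l z s" and E: "finite E"
    and d: "d > 0" and h: "h > 0"
    and \<epsilon>: "4 * (real (card E) + 1) * sqrt (2 * \<epsilon>) \<le> 1"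
    and void: "exp (- (l * (d ^ CARD('n) * h))) \<le> \<epsilon>"
    and weak: "measure M {\<omega>\<in>space M. s 0 \<omega> < b} \<le> \<epsilon>"
  shows "AE \<omega> in M. \<exists>\<Lambda> k. (\<forall>v. z (k v) \<omega> \<in> lattice_box d h r\<^sub>1 v (\<Lambda> v) \<and> b \<le> s (k v) \<omega>)
     \<and> (\<forall>v. \<forall>e\<in>E. \<Lambda> v \<le> Suc (\<Lambda> (v + e)))"
proof -
  interpret prob_space M by fact
  define C where "C v m = {\<omega>\<in>space M. \<forall>k. z k \<omega> \<in> lattice_box d h r\<^sub>1 v m \<longrightarrow> s k \<omega> < b}" for v :: "int ^ 'n" and m
  have borel: "lattice_box d h r\<^sub>1 v m \<in> sets borel" for v :: "int ^ 'n" and m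
    by (simp add: lattice_box_def)
  have above: "lattice_box d h r\<^sub>1 v m \<subseteq> UNIV \<times> {r\<^sub>1..}" for v :: "int ^ 'n" and m
  proof
    fix p assume "p \<in> lattice_box d h r\<^sub>1 v m"
    then have "r\<^sub>1 + h * of_nat m < snd p" by (cases p) (simp add: mem_lattice_box)
    moreover have "h * of_nat m \<ge> 0" using h by simp
    ultimately show "p \<in> UNIV \<times> {r\<^sub>1..}" by (cases p) auto
  qed
  have Cm: "C v m \<in> events" for v m
    unfolding C_def by (rule no_strong_obstacle_measurable[OF obs borel M])
  have q: "prob (space M \<inter> (\<Inter>(v, m)\<in>S. C v m)) \<le> (2 * \<epsilon>) ^ card S" if "finite S" for S
  proof -
    have "space M \<inter> (\<Inter>(v, m)\<in>S. C v m) =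
        {\<omega>\<in>space M. \<forall>t\<in>S. \<forall>k. z k \<omega> \<in> (\<lambda>(v, m). lattice_box d h r\<^sub>1 v m) t \<longrightarrow> s k \<omega> < b}"
      unfolding C_def by auto
    also have "prob \<dots> \<le> (2 * \<epsilon>) ^ card S"
    proof (rule no_strong_obstacle_probability[OF M obs that])
      fix t :: "(int ^ 'n) \<times> nat"
      obtain v m where t: "t = (v, m)" by (cases t)
      show "(\<lambda>(v, m). lattice_box d h r\<^sub>1 v m) t \<in> sets borel" using borel by (simp add: t)
      show "(\<lambda>(v, m). lattice_box d h r\<^sub>1 v m) t \<subseteq> UNIV \<times> {r\<^sub>1..}" using above by (simp add: t)
      show "emeasure lborel ((\<lambda>(v, m). lattice_box d h r\<^sub>1 v m) t) < \<infinity>"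
        by (simp add: t lattice_box_def emeasure_lborel_box_eq)
      show "exp (- (l * measure lborel ((\<lambda>(v, m). lattice_box d h r\<^sub>1 v m) t))) \<le> \<epsilon>"
        using void by (simp add: t measure_lattice_box[OF d h])
    next
      show "disjoint_family_on (\<lambda>(v, m). lattice_box d h r\<^sub>1 v m) S"
        unfolding disjoint_family_on_def
      proof (intro ballI impI)
        fix t t' :: "(int ^ 'n) \<times> nat" assume "t \<noteq> t'"
        moreover obtain v m v' m' where "t = (v, m)" "t' = (v', m')" by (cases t, cases t')
        ultimately show "(\<lambda>(v, m). lattice_box d h r\<^sub>1 v m) t \<inter> (\<lambda>(v, m). lattice_box d h r\<^sub>1 v m) t' = {}"
          using lattice_box_disjoint[OF d h, of _ r\<^sub>1 v m v' m'] by (auto simp del: split_paired_All)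
      qed
    qed (rule weak)
    finally show ?thesis .
  qed
  have "0 \<le> \<epsilon>" using weak measure_nonneg order_trans by blast
  then have "AE \<omega> in M. \<exists>\<Lambda>. (\<forall>v. \<omega> \<notin> C v (\<Lambda> v)) \<and> (\<forall>v. \<forall>e\<in>E. \<Lambda> v \<le> Suc (\<Lambda> (v + e)))"
    using q by (intro lipschitz_percolation[OF E Cm _ _ \<epsilon>]) auto
  with AE_space show ?thesis
  proof eventually_elim
    case (elim \<omega>)
    then obtain \<Lambda> where \<Lambda>: "\<And>v. \<omega> \<notin> C v (\<Lambda> v)" "\<forall>v. \<forall>e\<in>E. \<Lambda> v \<le> Suc (\<Lambda> (v + e))" by blast
    have "\<forall>v. \<exists>k. z k \<omega> \<in> lattice_box d h r\<^sub>1 v (\<Lambda> v) \<and> b \<le> s k \<omega>"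
      using \<Lambda>(1) elim(1) by (simp add: C_def not_less)
    then show ?case using \<Lambda>(2) by metis
  qed
qed

text \<open>
  Over the ball of radius \<open>r\<^sub>0\<close> the paraboloid stays within height \<open>r\<^sub>0\<close> of the centre, because
  \<open>a r\<^sub>0\<^sup>2 \<le> r\<^sub>0\<close>. There \<open>\<phi>\<close> is at most \<open>- 1\<close>.
\<close>

lemma obstacle_field_core:
  fixes \<phi> :: "(real ^ 'n) \<times> real \<Rightarrow> real"
  assumes shape: "obstacle_shape \<phi> r\<^sub>0 r\<^sub>1" and s: "\<And>k. 0 \<le> s k \<omega>"
    and fin: "\<And>r. finite {k. norm (z k \<omega>) \<le> r}"
    and k: "z k \<omega> = (p, y)" "b \<le> s k \<omega>" and a: "0 < a" "a * r\<^sub>0 \<le> 1" and r0: "0 < r\<^sub>0"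
    and near: "(norm (x - p))\<^sup>2 \<le> r\<^sub>0\<^sup>2"
  shows "obstacle_field \<phi> z s \<omega> x (y + a * (norm (x - p))\<^sup>2) \<le> - b"
proof -
  have "a * (norm (x - p))\<^sup>2 \<le> a * r\<^sub>0\<^sup>2" using near a(1) by (intro mult_left_mono) auto
  also have "\<dots> = (a * r\<^sub>0) * r\<^sub>0" by (simp add: power2_eq_square)
  also have "\<dots> \<le> r\<^sub>0" using a(2) r0 by (simp add: mult_left_le_one_le a(1) less_imp_le)
  finally have "infnorm (x - p, a * (norm (x - p))\<^sup>2) \<le> r\<^sub>0"
    using a(1) r0 near by (intro infnorm_pair_le) (auto intro: power2_le_imp_le)
  then have "\<phi> (x - p, a * (norm (x - p))\<^sup>2) \<le> - 1"
    using shape unfolding obstacle_shape_def by blast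
  then have "s k \<omega> * \<phi> (x - p, a * (norm (x - p))\<^sup>2) \<le> s k \<omega> * - 1"
    using s by (intro mult_left_mono) auto
  with obstacle_field_le[where z = z and s = s and \<omega> = \<omega> and x = x and y = "y + a * (norm (x - p))\<^sup>2" and k = k, OF shape s fin] k
  show ?thesis by simp
qed

theorem theorem2p15:
  fixes M :: "'\<omega> measure"
    and \<phi> :: "(real ^ 'n) \<times> real \<Rightarrow> real"
    and z :: "nat \<Rightarrow> '\<omega> \<Rightarrow> (real ^ 'n) \<times> real"
    and s :: "nat \<Rightarrow> '\<omega> \<Rightarrow> real"
    and r\<^sub>0 r\<^sub>1 l :: real
  assumes "prob_space M"
    and "obstacle_shape \<phi> r\<^sub>0 r\<^sub>1"
    and "obstacle_distribution M r\<^sub>1 l z s"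
  shows "\<exists>F\<^sub>s>0. \<exists>w :: real ^ 'n \<Rightarrow> '\<omega> \<Rightarrow> real.
     (\<forall>x. \<forall>\<omega>\<in>space M. w x \<omega> \<ge> 0) \<and>
     (AE \<omega> in M.
        stationary_supersolution (obstacle_field \<phi> z s \<omega>) F\<^sub>s (\<lambda>x. w x \<omega>) \<and>
        (\<forall>F\<le>F\<^sub>s. \<forall>U. comparison_class (obstacle_field \<phi> z s \<omega>) F U \<longrightarrow>
           (\<forall>u\<in>U. (\<forall>x. u x 0 = 0) \<longrightarrow> (\<forall>t\<ge>0. \<forall>x. u x t \<le> w x \<omega>))))"
proof -
  interpret prob_space M by fact
  define n where "n = real CARD('n)"
  have n: "n \<ge> 1" by (simp add: n_def Suc_le_eq)
  define \<beta> where "\<beta> = (n - 1 / 2) / 2"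
  have r: "sqrt n * r\<^sub>0 > 0" "r\<^sub>1 > sqrt n * r\<^sub>0"
    using assms(2) by (auto simp: obstacle_shape_def n_def)
  then have r1: "r\<^sub>1 > 0" by linarith
  have r0: "r\<^sub>0 > 0" using r n by (simp add: zero_less_mult_iff)
  have l: "l > 0" and z: "poisson_process M (UNIV \<times> {r\<^sub>1..}) l z"
    and s0: "\<And>k \<omega>. \<omega> \<in> space M \<Longrightarrow> 0 \<le> s k \<omega>" and pos: "AE \<omega> in M. s 0 \<omega> > 0"
    and inds: "indep_vars (\<lambda>_. borel) s UNIV"
    using assms(3) by (simp_all add: obstacle_distribution_def)
  \<comment> \<open>A barrier competes only with those of columns at most \<open>2 n + 1\<close> away; as all of these count as neighbours, one step of the Lipschitz condition compares them.\<close>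
  define E where "E = {e :: int ^ 'n. \<forall>i. \<bar>e $ i\<bar> \<le> 2 * int CARD('n) + 1}"
  have E: "finite E" unfolding E_def by (rule finite_int_cube)
  \<comment> \<open>Chosen such that \<open>2 * \<epsilon>\<close>, the bound for closed boxes, satisfies the smallness condition for percolation.\<close>
  define \<epsilon> where "\<epsilon> = (1 / (4 * (real (card E) + 1)))\<^sup>2 / 2"
  have \<epsilon>: "\<epsilon> > 0" "4 * (real (card E) + 1) * sqrt (2 * \<epsilon>) \<le> 1" by (auto simp: \<epsilon>_def)
  have "(1 / (4 * (real (card E) + 1)))\<^sup>2 \<le> 1" by (intro power_le_one) auto
  then have \<epsilon>1: "\<epsilon> < 1" by (simp add: \<epsilon>_def)
  have "s 0 \<in> borel_measurable M" using inds by (simp add: indep_vars_def2)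
  from exists_strength_threshold[OF assms(1) this pos \<epsilon>(1)]
  obtain b where b: "b > 0" "prob {\<omega>\<in>space M. s 0 \<omega> < b} \<le> \<epsilon>" by blast
  \<comment> \<open>The volume at which a box is void with probability \<open>\<epsilon>\<close>.\<close>
  define C where "C = - ln \<epsilon> / l"
  have C: "C > 0" "exp (- (l * C)) = \<epsilon>" using \<epsilon> \<epsilon>1 l by (auto simp: C_def divide_neg_pos)
  \<comment> \<open>Half of the strength \<open>b\<close> pays for the curvature \<open>2 a\<close> of the paraboloid, the other half for \<open>F\<^sub>s\<close>. The other bounds keep the paraboloid inside the obstacle and its slope small.\<close>
  define a where "a = min (b / 4) (min (1 / r\<^sub>0) (1 / (3 * r\<^sub>0 * n)))"
  have a: "a > 0" "a \<le> b / 4" using b r0 n by (simp_all add: a_def)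
  have "a \<le> 1 / r\<^sub>0" "a \<le> 1 / (3 * r\<^sub>0 * n)" by (simp_all add: a_def)
  then have ar: "a * r\<^sub>0 \<le> 1" and "a * (3 * r\<^sub>0 * n) \<le> 1"
    using r0 n by (simp_all add: pos_le_divide_eq)
  have a8: "8 * a\<^sup>2 * r\<^sub>0\<^sup>2 * n \<le> 1"
  proof -
    have "a * r\<^sub>0 * n \<le> 1 / 3" using \<open>a * (3 * r\<^sub>0 * n) \<le> 1\<close> by simp
    then have "(a * r\<^sub>0 * n)\<^sup>2 \<le> (1 / 3)\<^sup>2" using a r0 n by (intro power_mono) auto
    moreover have "a\<^sup>2 * r\<^sub>0\<^sup>2 * n * 1 \<le> a\<^sup>2 * r\<^sub>0\<^sup>2 * n * n" using n by (intro mult_left_mono) auto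
    moreover have "(a * r\<^sub>0 * n)\<^sup>2 = a\<^sup>2 * r\<^sub>0\<^sup>2 * n * n" "(1 / 3 :: real)\<^sup>2 = 1 / 9"
      by (simp_all add: power_mult_distrib power2_eq_square)
    moreover have "0 \<le> a\<^sup>2 * r\<^sub>0\<^sup>2 * n" using n by simp
    ultimately show ?thesis by linarith
  qed
  have q0: "r\<^sub>0\<^sup>2 > 0" using r0 by simp
  from exists_cell_size[OF a(1) q0 C(1) n]
  obtain d where d: "d > 0" and gap: "2 * (C / d powr n) + profile a (r\<^sub>0\<^sup>2) \<beta> ((n * d)\<^sup>2) \<le> profile a (r\<^sub>0\<^sup>2) \<beta> ((2 * n * d)\<^sup>2)"
    unfolding \<beta>_def by blast
  define h where "h = C / d powr n"
  have h: "h > 0" "d ^ CARD('n) * h = C" using C d by (auto simp: h_def n_def powr_realpow)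
  define F\<^sub>s where "F\<^sub>s = min (b / 2) (a / n * ((2 * n * d)\<^sup>2 / r\<^sub>0\<^sup>2) powr (- \<beta> - 1))"
  have "a / n * ((2 * n * d)\<^sup>2 / r\<^sub>0\<^sup>2) powr (- \<beta> - 1) > 0" using a n d r0 by simp
  then have Fs: "F\<^sub>s > 0" "F\<^sub>s \<le> b / 2" "F\<^sub>s \<le> a / n * ((2 * n * d)\<^sup>2 / r\<^sub>0\<^sup>2) powr (- \<beta> - 1)"
    unfolding F\<^sub>s_def using b(1) by (simp_all only: min.cobounded1 min.cobounded2 min_less_iff_conj half_gt_zero_iff)
  define good where "good \<omega> v \<longleftrightarrow> (\<forall>x. 0 \<le> v x) \<and> stationary_supersolution (obstacle_field \<phi> z s \<omega>) F\<^sub>s v" for \<omega> v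
  have "AE \<omega> in M. \<exists>v. good \<omega> v"
    using AE_space poisson_process_locally_finite[OF assms(1) z borel_closed[OF closed_Times[OF closed_UNIV closed_atLeast]]]
      strong_obstacle_surface[OF assms(1,3) E d h(1) \<epsilon>(2) _ b(2), unfolded h(2), OF eq_refl[OF C(2)]]
  proof eventually_elim
    case (elim \<omega>)
    then obtain \<Lambda> k where k: "\<And>v. z (k v) \<omega> \<in> lattice_box d h r\<^sub>1 v (\<Lambda> v)" "\<And>v. b \<le> s (k v) \<omega>"
      and lip: "\<forall>v. \<forall>e\<in>E. \<Lambda> v \<le> Suc (\<Lambda> (v + e))" by blast
    have s\<omega>: "0 \<le> s j \<omega>" for j using s0 elim(1) by blast
    have fin: "finite {j. norm (z j \<omega>) \<le> R}" for R using elim(2) by blast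
    define X where "X v = fst (z (k v) \<omega>)" for v
    define Y where "Y v = snd (z (k v) \<omega>)" for v
    have XY: "z (k v) \<omega> = (X v, Y v)" for v by (simp add: X_def Y_def)
    let ?f = "obstacle_field \<phi> z s \<omega>"
    have f0: "?f x y \<le> 0" for x y
    proof (rule order_trans[OF obstacle_field_le[where z = z and s = s and \<omega> = \<omega> and x = x and y = y and k = 0, OF assms(2) s\<omega> fin]])
      show "s 0 \<omega> * \<phi> ((x, y) - z 0 \<omega>) \<le> 0"
        using assms(2) s\<omega> unfolding obstacle_shape_def by (intro mult_nonneg_nonpos) blast+
    qed
    have core: "?f x (Y v + a * (norm (x - X v))\<^sup>2) \<le> - (2 * a + F\<^sub>s)" if "(norm (x - X v))\<^sup>2 \<le> r\<^sub>0\<^sup>2" for x v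
      using obstacle_field_core[where z = z and s = s and \<omega> = \<omega>, OF assms(2) s\<omega> fin XY k(2) a(1) ar r0 that] a(2) Fs(2) by linarith
    have \<Lambda>: "\<Lambda> v \<le> Suc (\<Lambda> (v + e))" if "\<forall>i. \<bar>e $ i\<bar> \<le> 2 * int CARD('n) + 1" for v e
      using lip that by (simp add: E_def)
    note surf = lipschitz_surface_supersolution[where X = X and Y = Y and f = ?f and F = F\<^sub>s and \<Lambda> = \<Lambda> and r = r\<^sub>1,
        OF a(1) a8[unfolded n_def] q0 d h(1) gap[folded h_def, unfolded \<beta>_def n_def]
          Fs(3)[unfolded \<beta>_def n_def] k(1)[unfolded XY] _ f0, folded n_def, folded \<beta>_def]
    have "stationary_supersolution ?f F\<^sub>s (barrier_min a (r\<^sub>0\<^sup>2) \<beta> (2 * n * d) X Y)"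
      by (rule surf(1)) (erule \<Lambda> core)+
    moreover have "0 \<le> barrier_min a (r\<^sub>0\<^sup>2) \<beta> (2 * n * d) X Y x" for x
      by (rule surf(2)) ((erule \<Lambda> core)+, rule less_imp_le[OF r1])
    ultimately have "good \<omega> (barrier_min a (r\<^sub>0\<^sup>2) \<beta> (2 * n * d) X Y)" by (simp add: good_def)
    then show ?case by blast
  qed
  \<comment> \<open>Outside the almost sure event any nonnegative function will do.\<close>
  define w where "w x \<omega> = (if \<exists>v. good \<omega> v then (SOME v. good \<omega> v) x else 0)" for x \<omega>
  have w: "0 \<le> w x \<omega>" for x \<omega>
    using someI_ex[of "good \<omega>"] by (auto simp: w_def good_def)
  have good_w: "good \<omega> (\<lambda>x. w x \<omega>)" if "\<exists>v. good \<omega> v" for \<omega>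
    using someI_ex[OF that] that by (simp add: w_def)
  show ?thesis
  proof (intro exI[of _ F\<^sub>s] exI[of _ w] conjI Fs(1) allI ballI w)
    show "AE \<omega> in M.
        stationary_supersolution (obstacle_field \<phi> z s \<omega>) F\<^sub>s (\<lambda>x. w x \<omega>) \<and>
        (\<forall>F\<le>F\<^sub>s. \<forall>U. comparison_class (obstacle_field \<phi> z s \<omega>) F U \<longrightarrow>
           (\<forall>u\<in>U. (\<forall>x. u x 0 = 0) \<longrightarrow> (\<forall>t\<ge>0. \<forall>x. u x t \<le> w x \<omega>)))"
      using \<open>AE \<omega> in M. \<exists>v. good \<omega> v\<close>
    proof eventually_elim
      case (elim \<omega>)
      let ?f = "obstacle_field \<phi> z s \<omega>"
      have super: "stationary_supersolution ?f F\<^sub>s (\<lambda>x. w x \<omega>)"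
        using good_w[OF elim] by (simp add: good_def)
      have "u x t \<le> w x \<omega>"
        if F: "F \<le> F\<^sub>s" and U: "comparison_class ?f F U" "u \<in> U" "\<forall>x. u x 0 = 0" "t \<ge> 0" for F U u t x
      proof -
        \<comment> \<open>The supersolution property is inherited by all smaller driving forces.\<close>
        have "stationary_supersolution ?f F (\<lambda>x. w x \<omega>)"
          using super F unfolding stationary_supersolution_def by (meson add_left_mono order_trans)
        moreover have "\<forall>x. u x 0 \<le> w x \<omega>" using U(3) w by simp
        ultimately show ?thesis using U(1,2,4) unfolding comparison_class_def by blast
      qed
      with super show ?case by blast
    qed
  qed
qed

end
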